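(* Let $r\ge 3$, $l\ge 4$ and $s\ge 1$ be integers. (i) If either $l=2t$ and $r\ge s+2$, or $l=2t+1$ and $r\ge s+3$, for some integer $t\ge 2$, then $\mathrm{mex}(m,K_r,K_s\vee C_l)=O\!\left(m^{\frac{s+1}{2}+\frac{1}{2t}}\right)$. (ii) Otherwise, $\mathrm{mex}(m,K_r,K_s\vee C_l)=\Theta(m^{r/2})$.
   Context: $\mathrm{mex}(m,K_r,F)$ is the maximum number of copies of $K_r$ in an $F$-free simple graph with $m$ edges. $C_l$ is the cycle on $l$ vertices. For graphs $G,H$, $G\vee H$ is the graph on $V(G)\cup V(H)$ (disjoint) with edge set $E(G)\cup E(H)\cup\{xy: x\in V(G), y\in V(H)\}$. Asymptotics are as $m\to\infty$. *)

theory Defs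
  imports Complex_Main "HOL-Library.Landau_Symbols"
begin

datatype 'a sgraph = SGraph (verts: "'a set") (edges: "'a set set")

definition simple_graph :: "'a sgraph \<Rightarrow> bool" where
  "simple_graph G \<longleftrightarrow> finite (verts G) \<and> edges G \<subseteq> {e. e \<subseteq> verts G \<and> card e = 2}"

definition complete_graph :: "nat \<Rightarrow> nat sgraph" where
  "complete_graph r = SGraph {..<r} {e. e \<subseteq> {..<r} \<and> card e = 2}"

text \<open>A simple graph, and then the cycle on \<open>l\<close> vertices, only for \<open>l \<ge> 3\<close>.\<close>

definition cycle_graph :: "nat \<Rightarrow> nat sgraph" where
  "cycle_graph l = SGraph {..<l} {{i, Suc i mod l} | i. i < l}"

definition graph_join :: "'a sgraph \<Rightarrow> 'b sgraph \<Rightarrow> ('a + 'b) sgraph" where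
  "graph_join G H = SGraph (verts G <+> verts H)
     ((\<lambda>e. Inl ` e) ` edges G \<union> (\<lambda>e. Inr ` e) ` edges H
       \<union> {{Inl x, Inr y} | x y. x \<in> verts G \<and> y \<in> verts H})"

definition subgraph :: "'a sgraph \<Rightarrow> 'a sgraph \<Rightarrow> bool" where
  "subgraph H G \<longleftrightarrow> simple_graph H \<and> verts H \<subseteq> verts G \<and> edges H \<subseteq> edges G"

definition graph_iso :: "'a sgraph \<Rightarrow> 'b sgraph \<Rightarrow> bool" where
  "graph_iso G H \<longleftrightarrow>
     (\<exists>f. bij_betw f (verts G) (verts H) \<and> edges H = (\<lambda>e. f ` e) ` edges G)"

text \<open>Copies are subgraphs, not necessarily induced; two embeddings with the same image
  give the same copy.\<close>

definition copies :: "'a sgraph \<Rightarrow> 'b sgraph \<Rightarrow> 'b sgraph set" where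
  "copies H G = {H'. subgraph H' G \<and> graph_iso H H'}"

definition graph_free :: "'a sgraph \<Rightarrow> 'b sgraph \<Rightarrow> bool" where
  "graph_free F G \<longleftrightarrow> copies F G = {}"

text \<open>Host graphs have vertices in \<^typ>\<open>nat\<close>, which covers all finite graphs up to
  isomorphism. The number of vertices is not bounded, so the maximum is over a finite set
  only if \<open>H\<close> has no isolated vertices (then every copy of \<open>H\<close> lies on the at most \<open>2 m\<close>
  non-isolated vertices); for \<open>H = K\<^sub>r\<close> this means \<open>r \<ge> 2\<close>. The set is nonempty as soon as a
  matching with \<open>m\<close> edges is \<open>F\<close>-free.\<close>

definition mex :: "nat \<Rightarrow> 'a sgraph \<Rightarrow> 'b sgraph \<Rightarrow> nat" where
  "mex m H F = Max {card (copies H G) | G :: nat sgraph.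
     simple_graph G \<and> card (edges G) = m \<and> graph_free F G}"

end

theory Submission imports Defs "HOL-Library.Ramsey" begin

text \<open>Upper bounds: a vertex of minimum degree in a clique sees the rest of the clique inside a set
  of at most \<open>sqrt (2m)\<close> neighbours, and this set is \<open>K\<^bsub>s-1\<^esub> \<or> C\<^sub>l\<close>-free. So it suffices to
  show that an \<open>n\<close>-vertex \<open>K\<^sub>s \<or> C\<^sub>l\<close>-free graph has \<open>O(n\<^bsup>s+1+1/t\<^esup>)\<close> cliques \<open>K\<^sub>r\<close>, where
  \<open>t = l div 2\<close>; passing to neighbourhoods reduces this to \<open>s = 0\<close>. There neighbourhoods contain no
  long paths, hence are degenerate, and the cliques are bounded by the number of edges, or of edges
  in triangles if \<open>l\<close> is odd. For \<open>l = 2t\<close> these are \<open>O(n\<^bsup>1+1/t\<^esup>)\<close> by the Bondy-Simonovits theorem,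
  which is proved by breadth-first search: consecutive layers span few edges, so layers grow by a
  factor proportional to the degree. The odd case reduces to the even one by a random vertex
  partition.

  Lower bound: \<open>K\<^sub>s \<or> C\<^sub>l\<close> has chromatic number \<open>s + 2 + l mod 2\<close>, and case (ii) says that \<open>r\<close> is
  smaller. So a balanced complete \<open>r\<close>-partite graph, with a matching added to reach \<open>m\<close> edges
  exactly, does not contain it.\<close>

section \<open>Neighbourhoods, cliques and cycles of a relation\<close>

definition neighbours :: "('a \<Rightarrow> 'a \<Rightarrow> bool) \<Rightarrow> 'a set \<Rightarrow> 'a \<Rightarrow> 'a set" where
  "neighbours E V v = {u \<in> V. E v u}"

abbreviation deg :: "('a \<Rightarrow> 'a \<Rightarrow> bool) \<Rightarrow> 'a set \<Rightarrow> 'a \<Rightarrow> nat" where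
  "deg E V v \<equiv> card (neighbours E V v)"

definition arcs :: "('a \<Rightarrow> 'a \<Rightarrow> bool) \<Rightarrow> 'a set \<Rightarrow> 'a set \<Rightarrow> ('a \<times> 'a) set" where
  "arcs E A B = {(u, v). u \<in> A \<and> v \<in> B \<and> E u v}"

definition cliques :: "('a \<Rightarrow> 'a \<Rightarrow> bool) \<Rightarrow> 'a set \<Rightarrow> nat \<Rightarrow> 'a set set" where
  "cliques E V q = {S. S \<subseteq> V \<and> card S = q \<and> (\<forall>x\<in>S. \<forall>y\<in>S. x \<noteq> y \<longrightarrow> E x y)}"

definition is_path :: "('a \<Rightarrow> 'a \<Rightarrow> bool) \<Rightarrow> 'a set \<Rightarrow> 'a list \<Rightarrow> bool" where
  "is_path E V xs \<longleftrightarrow> xs \<noteq> [] \<and> distinct xs \<and> set xs \<subseteq> V \<and> successively E xs"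

text \<open>A cycle of length \<open>2\<close> is a single edge.\<close>

definition has_cycle :: "('a \<Rightarrow> 'a \<Rightarrow> bool) \<Rightarrow> 'a set \<Rightarrow> nat \<Rightarrow> bool" where
  "has_cycle E V l \<longleftrightarrow> (\<exists>xs. is_path E V xs \<and> E (last xs) (hd xs) \<and> length xs = l)"

lemma neighbours_subset: "neighbours E V v \<subseteq> V"
  by (auto simp: neighbours_def)

lemma finite_neighbours [simp]: "finite V \<Longrightarrow> finite (neighbours E V v)"
  by (rule finite_subset[OF neighbours_subset])

lemma arcs_eq_Sigma: "arcs E A B = Sigma A (neighbours E B)"
  by (auto simp: arcs_def neighbours_def)

lemma finite_arcs [simp]: "finite A \<Longrightarrow> finite B \<Longrightarrow> finite (arcs E A B)"
  by (simp add: arcs_eq_Sigma)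

lemma card_arcs: "finite A \<Longrightarrow> finite B \<Longrightarrow> card (arcs E A B) = (\<Sum>v\<in>A. deg E B v)"
  by (simp add: arcs_eq_Sigma)

lemma card_arcs_commute:
  assumes "symp E"
  shows "card (arcs E A B) = card (arcs E B A)"
proof -
  have "arcs E A B = prod.swap ` arcs E B A"
    using sympD[OF assms] by (auto simp: arcs_def image_iff)
  then show ?thesis by (simp add: card_image)
qed

lemma finite_cliques [simp]: "finite V \<Longrightarrow> finite (cliques E V q)"
  by (rule finite_subset[of _ "Pow V"]) (auto simp: cliques_def)

lemma is_path_Cons:
  "is_path E V (x # xs) \<longleftrightarrow> x \<in> V \<and> (xs = [] \<or> x \<notin> set xs \<and> E x (hd xs) \<and> is_path E V xs)"
  by (auto simp: is_path_def successively_Cons)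

lemma is_path_append:
  assumes "is_path E V xs" "is_path E V ys" "set xs \<inter> set ys = {}" "E (last xs) (hd ys)"
  shows "is_path E V (xs @ ys)"
  using assms by (auto simp: is_path_def successively_append_iff)

lemma is_path_mono:
  assumes "is_path E V xs" "V \<subseteq> W" "\<And>u v. u \<in> V \<Longrightarrow> v \<in> V \<Longrightarrow> E u v \<Longrightarrow> E' u v"
  shows "is_path E' W xs"
proof -
  have "successively E' xs"
    by (rule successively_mono[of E]) (use assms in \<open>auto simp: is_path_def\<close>)
  then show ?thesis using assms(1,2) by (auto simp: is_path_def)
qed

lemma has_cycle_mono:
  assumes "has_cycle E V l" "V \<subseteq> W" "\<And>u v. u \<in> V \<Longrightarrow> v \<in> V \<Longrightarrow> E u v \<Longrightarrow> E' u v"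
  shows "has_cycle E' W l"
proof -
  obtain xs where xs: "is_path E V xs" "E (last xs) (hd xs)" "length xs = l"
    using assms(1) by (auto simp: has_cycle_def)
  then have "last xs \<in> V" "hd xs \<in> V" by (auto simp: is_path_def)
  then show ?thesis
    using xs assms(3) is_path_mono[OF xs(1) assms(2)] unfolding has_cycle_def by blast
qed

lemma has_cycle_Suc:
  assumes "is_path E V xs" "v \<in> V - set xs" "E v (hd xs)" "E (last xs) v"
  shows "has_cycle E V (Suc (length xs))"
  unfolding has_cycle_def
  using assms by (intro exI[of _ "v # xs"]) (auto simp: is_path_def successively_Cons)

lemma greedy_path:
  assumes W: "finite W" "\<And>w. w \<in> W \<Longrightarrow> d \<le> deg E W w" and irrefl: "irreflp E"
    and "finite F" "x \<in> W - F" "card F + n \<le> d"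
  shows "\<exists>xs. is_path E (W - F) xs \<and> hd xs = x \<and> length xs = Suc n"
  using assms(4-)
proof (induction n arbitrary: F x)
  case 0
  then show ?case by (intro exI[of _ "[x]"]) (simp add: is_path_def)
next
  case (Suc n)
  have "\<not> neighbours E W x \<subseteq> F"
    using card_mono[OF \<open>finite F\<close>, of "neighbours E W x"] W(2)[of x] Suc.prems by fastforce
  then obtain y where y: "y \<in> W - F" "E x y" by (auto simp: neighbours_def)
  then have "x \<noteq> y" using irreflpD[OF irrefl] by metis
  have "\<exists>xs. is_path E (W - insert x F) xs \<and> hd xs = y \<and> length xs = Suc n"
    using Suc.prems y \<open>x \<noteq> y\<close> by (intro Suc.IH) (auto simp: card_insert_if)
  then obtain xs where xs: "is_path E (W - insert x F) xs" "hd xs = y" "length xs = Suc n"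
    by blast
  moreover have "is_path E (W - F) xs" by (rule is_path_mono[OF xs(1)]) auto
  ultimately show ?case using y Suc.prems
    by (intro exI[of _ "x # xs"]) (auto simp: is_path_def successively_Cons)
qed

section \<open>Degeneracy\<close>

definition degenerate :: "('a \<Rightarrow> 'a \<Rightarrow> bool) \<Rightarrow> 'a set \<Rightarrow> nat \<Rightarrow> bool" where
  "degenerate E V d \<longleftrightarrow> (\<forall>W\<subseteq>V. W \<noteq> {} \<longrightarrow> (\<exists>w\<in>W. deg E W w \<le> d))"

lemma degenerateI:
  assumes "\<And>W. W \<subseteq> V \<Longrightarrow> W \<noteq> {} \<Longrightarrow> (\<And>w. w \<in> W \<Longrightarrow> d < deg E W w) \<Longrightarrow> False"
  shows "degenerate E V d"
  unfolding degenerate_def using assms by (meson not_le)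

lemma degenerate_induct [consumes 2, case_names empty remove]:
  assumes "finite V" "degenerate E V d"
    and empty: "P {}"
    and remove: "\<And>V v. finite V \<Longrightarrow> v \<in> V \<Longrightarrow> deg E V v \<le> d \<Longrightarrow> P (V - {v}) \<Longrightarrow> P V"
  shows "P V"
  using assms(1,2)
proof (induction V rule: finite_psubset_induct)
  case (psubset V)
  show ?case
  proof (cases "V = {}")
    case False
    then obtain v where v: "v \<in> V" "deg E V v \<le> d"
      using psubset.prems by (auto simp: degenerate_def)
    have "degenerate E (V - {v}) d"
      using psubset.prems by (auto simp: degenerate_def)
    then have "P (V - {v})" using v by (intro psubset.IH) auto
    then show ?thesis using remove psubset.hyps v by blast
  qed (simp add: empty)
qed

lemma card_arcs_remove:
  assumes "finite V" "symp E"
  shows "card (arcs E V V) \<le> card (arcs E (V - {v}) (V - {v})) + 2 * deg E V v"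
proof -
  let ?out = "Pair v ` neighbours E V v" and ?in = "(\<lambda>u. (u, v)) ` neighbours E V v"
  have "arcs E V V \<subseteq> arcs E (V - {v}) (V - {v}) \<union> (?out \<union> ?in)"
    using sympD[OF assms(2)] by (auto simp: arcs_def neighbours_def)
  then have "card (arcs E V V) \<le> card (arcs E (V - {v}) (V - {v}) \<union> (?out \<union> ?in))"
    using assms(1) by (intro card_mono) auto
  also have "\<dots> \<le> card (arcs E (V - {v}) (V - {v})) + (card ?out + card ?in)"
    by (meson add_left_mono card_Un_le order_trans)
  also have "\<dots> \<le> card (arcs E (V - {v}) (V - {v})) + (deg E V v + deg E V v)"
    using assms(1) by (intro add_left_mono add_mono card_image_le) auto
  finally show ?thesis by simp
qed

lemma card_arcs_degenerate:
  assumes "finite V" "symp E" "degenerate E V d"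
  shows "card (arcs E V V) \<le> 2 * d * card V"
  using assms(1,3)
proof (induction rule: degenerate_induct)
  case empty
  then show ?case by (simp add: arcs_def)
next
  case (remove V v)
  have "card (arcs E V V) \<le> card (arcs E (V - {v}) (V - {v})) + 2 * deg E V v"
    by (rule card_arcs_remove[OF remove.hyps(1) assms(2)])
  also have "\<dots> \<le> 2 * d * card (V - {v}) + 2 * d"
    using remove by (intro add_mono mult_left_mono) auto
  also have "\<dots> = 2 * d * card V"
    unfolding card.remove[OF remove.hyps(1,2)] by simp
  finally show ?case .
qed

lemma card_cliques_remove:
  assumes "finite V"
  shows "card (cliques E V q) \<le> card (cliques E (V - {v}) q) + 2 ^ deg E V v"
proof -
  let ?through_v = "insert v ` Pow (neighbours E V v)"
  have "S \<in> cliques E (V - {v}) q \<union> ?through_v" if S: "S \<in> cliques E V q" for S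
  proof (cases "v \<in> S")
    case True
    then have "S = insert v (S - {v})" "S - {v} \<in> Pow (neighbours E V v)"
      using S by (auto simp: cliques_def neighbours_def)
    then show ?thesis by blast
  qed (use S in \<open>auto simp: cliques_def\<close>)
  then have "card (cliques E V q) \<le> card (cliques E (V - {v}) q \<union> ?through_v)"
    using assms by (intro card_mono) auto
  also have "\<dots> \<le> card (cliques E (V - {v}) q) + card ?through_v" by (rule card_Un_le)
  also have "card ?through_v \<le> card (Pow (neighbours E V v))"
    using assms by (intro card_image_le) auto
  finally show ?thesis using assms by (simp add: card_Pow)
qed

lemma card_cliques_degenerate:
  assumes "finite V" "degenerate E V d" "q \<ge> 1"
  shows "card (cliques E V q) \<le> 2 ^ d * card V"
  using assms(1,2)
proof (induction rule: degenerate_induct)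
  case empty
  then show ?case using assms(3) by (auto simp: cliques_def)
next
  case (remove V v)
  have "card (cliques E V q) \<le> card (cliques E (V - {v}) q) + 2 ^ deg E V v"
    by (rule card_cliques_remove[OF remove.hyps(1)])
  also have "\<dots> \<le> 2 ^ d * card (V - {v}) + 2 ^ d"
    using remove by (intro add_mono) auto
  also have "\<dots> = 2 ^ d * card V"
    unfolding card.remove[OF remove.hyps(1,2)] by simp
  finally show ?case .
qed

section \<open>Even cycles\<close>

definition between :: "('a \<Rightarrow> 'a \<Rightarrow> bool) \<Rightarrow> 'a set \<Rightarrow> 'a set \<Rightarrow> 'a \<Rightarrow> 'a \<Rightarrow> bool" where
  "between E X Y u v \<longleftrightarrow> E u v \<and> (u \<in> X \<and> v \<in> Y \<or> u \<in> Y \<and> v \<in> X)"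

lemma symp_between: "symp E \<Longrightarrow> symp (between E X Y)"
  unfolding symp_def between_def by blast

lemma irreflp_between: "irreflp E \<Longrightarrow> irreflp (between E X Y)"
  unfolding irreflp_def between_def by blast

lemma between_sides:
  assumes "between E X Y u v" "X = Y \<or> X \<inter> Y = {}"
  shows "u \<in> X \<longleftrightarrow> v \<in> Y" "u \<in> Y \<longleftrightarrow> v \<in> X"
  using assms by (auto simp: between_def)

lemma neighbours_between_subset:
  assumes "w \<in> Y" "X = Y \<or> X \<inter> Y = {}"
  shows "neighbours (between E X Y) W w \<subseteq> X"
  using assms by (auto simp: neighbours_def between_def)

definition siblings_agree :: "('a \<Rightarrow> 'a \<Rightarrow> bool) \<Rightarrow> 'a set \<Rightarrow> 'a set \<Rightarrow> ('a \<Rightarrow> 'b) \<Rightarrow> bool" where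
  "siblings_agree E W Y f \<longleftrightarrow>
    (\<forall>w\<in>W \<inter> Y. \<forall>a\<in>neighbours E W w. \<forall>b\<in>neighbours E W w. f a = f b)"

lemma even_path_last_eq:
  assumes E: "symp E" and XY: "X = Y \<or> X \<inter> Y = {}"
    and agree: "siblings_agree (between E X Y) W Y f"
    and "is_path (between E X Y) W ps" "hd ps \<in> X" "length ps = 2 * n + 1"
  shows "last ps \<in> X \<and> f (last ps) = f (hd ps)"
  using assms(4-)
proof (induction n arbitrary: ps)
  case 0
  then show ?case by (cases ps) auto
next
  case (Suc n)
  then obtain x y qs where ps: "ps = x # y # qs" "length qs = 2 * n + 1"
    by (cases ps; cases "tl ps") auto
  then have "qs \<noteq> []" by auto
  then have edges: "between E X Y x y" "between E X Y y (hd qs)"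
    and qs: "is_path (between E X Y) W qs" and W: "x \<in> W" "y \<in> W" "hd qs \<in> W"
    using Suc.prems(1) ps by (auto simp: is_path_def successively_Cons)
  have sides: "y \<in> Y" "hd qs \<in> X"
    using edges Suc.prems(2) ps between_sides[OF _ XY] by auto
  then have "x \<in> neighbours (between E X Y) W y" "hd qs \<in> neighbours (between E X Y) W y"
    using edges W sympD[OF symp_between[OF E]] by (auto simp: neighbours_def)
  then have "f x = f (hd qs)" using agree W sides unfolding siblings_agree_def by blast
  then show ?case using Suc.IH[OF qs sides(2) ps(2)] ps \<open>qs \<noteq> []\<close> by simp
qed

lemma even_path_avoiding:
  assumes E: "symp E" "irreflp E" and XY: "X = Y \<or> X \<inter> Y = {}"
    and W: "finite W" "\<And>w. w \<in> W \<Longrightarrow> d \<le> deg (between E X Y) W w"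
    and agree: "siblings_agree (between E X Y) W Y f"
    and z: "z \<in> W - F" "z \<in> X" and F: "finite F" "card F + 2 * n \<le> d"
  shows "\<exists>ps. is_path (between E X Y) (W - F) ps \<and> hd ps = z \<and> length ps = 2 * n + 1
    \<and> last ps \<in> X \<and> f (last ps) = f z"
proof -
  obtain ps where ps: "is_path (between E X Y) (W - F) ps" "hd ps = z" "length ps = 2 * n + 1"
    using greedy_path[OF W irreflp_between[OF E(2)] F(1) z(1) F(2)] by auto
  have "is_path (between E X Y) W ps" by (rule is_path_mono[OF ps(1)]) auto
  then have "last ps \<in> X \<and> f (last ps) = f (hd ps)"
    using even_path_last_eq[OF E(1) XY agree] ps z(2) by blast
  then show ?thesis using ps by blast
qed

locale breadth_first_search =
  fixes E :: "'a \<Rightarrow> 'a \<Rightarrow> bool" and V :: "'a set" and root :: 'a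
  assumes symp: "symp E" and irreflp: "irreflp E" and finite: "finite V" and root: "root \<in> V"
begin

definition layer :: "nat \<Rightarrow> 'a set" where
  "layer i = {y. (root, y) \<in> arcs E V V ^^ i \<and> (\<forall>h<i. (root, y) \<notin> arcs E V V ^^ h)}"

lemma layer_0: "layer 0 = {root}"
  by (auto simp: layer_def)

lemma layer_subset: "layer i \<subseteq> V"
  using root by (cases i) (auto simp: layer_def arcs_def)

lemma finite_layer: "finite (layer i)"
  using layer_subset finite by (rule finite_subset)

lemma layers_disjoint: "i \<noteq> j \<Longrightarrow> layer i \<inter> layer j = {}"
  by (cases i j rule: linorder_cases) (auto simp: layer_def)

lemma ex_parent:
  assumes "y \<in> layer (Suc i)"
  shows "\<exists>p\<in>layer i. E y p"
proof -
  obtain p where p: "(root, p) \<in> arcs E V V ^^ i" "(p, y) \<in> arcs E V V"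
    using assms by (auto simp: layer_def)
  have "(root, p) \<notin> arcs E V V ^^ h" if "h < i" for h
    using relpow_Suc_I[OF _ p(2), of root h] assms that by (auto simp: layer_def)
  then show ?thesis using p sympD[OF symp] by (auto simp: layer_def arcs_def)
qed

lemma neighbours_layer_subset:
  assumes y: "y \<in> layer i"
  shows "neighbours E V y \<subseteq> layer (i - 1) \<union> layer i \<union> layer (Suc i)"
proof
  fix u assume "u \<in> neighbours E V y"
  then have yu: "(y, u) \<in> arcs E V V" "(u, y) \<in> arcs E V V"
    using layer_subset y sympD[OF symp] by (auto simp: neighbours_def arcs_def)
  define j where "j = (LEAST j. (root, u) \<in> arcs E V V ^^ j)"
  have "(root, u) \<in> arcs E V V ^^ Suc i"
    using relpow_Suc_I[OF _ yu(1)] y by (simp add: layer_def)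
  then have reach_j: "(root, u) \<in> arcs E V V ^^ j" "j \<le> Suc i"
    unfolding j_def by (rule LeastI, rule Least_le)
  then have "u \<in> layer j"
    using not_less_Least by (auto simp: layer_def j_def)
  moreover have "i \<le> Suc j"
    using relpow_Suc_I[OF reach_j(1) yu(2)] y unfolding layer_def mem_Collect_eq by (meson not_le)
  then have "j = i - 1 \<or> j = i \<or> j = Suc i" using reach_j(2) by linarith
  ultimately show "u \<in> layer (i - 1) \<union> layer i \<union> layer (Suc i)" by auto
qed

lemma neighbours_root_subset: "neighbours E V root \<subseteq> layer 1"
  using neighbours_layer_subset[of root 0] irreflpD[OF irreflp]
  by (auto simp: layer_0 neighbours_def)

definition parent :: "'a \<Rightarrow> 'a" where
  "parent y = (SOME p. E y p \<and> (\<exists>i. y \<in> layer (Suc i) \<and> p \<in> layer i))"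

lemma
  assumes y: "y \<in> layer (Suc i)"
  shows parent_layer: "parent y \<in> layer i" and parent_edge: "E y (parent y)"
proof -
  have "\<exists>p. E y p \<and> (\<exists>i. y \<in> layer (Suc i) \<and> p \<in> layer i)"
    using ex_parent[OF y] y by blast
  from someI_ex[OF this] have "E y (parent y)" "\<exists>j. y \<in> layer (Suc j) \<and> parent y \<in> layer j"
    unfolding parent_def by auto
  moreover have "j = i" if "y \<in> layer (Suc j)" for j
    using y layers_disjoint[of "Suc i" "Suc j"] that by auto
  ultimately show "E y (parent y)" "parent y \<in> layer i" by auto
qed

lemma ancestor_root: "y \<in> layer i \<Longrightarrow> (parent ^^ i) y = root"
  by (induction i arbitrary: y)
    (auto simp: layer_0 funpow_Suc_right parent_layer simp del: funpow.simps)

text \<open>This is the tree path from \<open>x\<close> up to the lowest common ancestor and down to \<open>y\<close>, without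
  its two ends.\<close>

lemma tree_path:
  assumes "x \<in> layer i" "y \<in> layer i" "j < i"
    and "(parent ^^ j) x \<noteq> (parent ^^ j) y" "(parent ^^ Suc j) x = (parent ^^ Suc j) y"
  shows "\<exists>ps. is_path E (\<Union>h<i. layer h) ps \<and> hd ps = parent x \<and> last ps = parent y
    \<and> length ps = 2 * j + 1"
  using assms
proof (induction j arbitrary: x y i)
  case 0
  then obtain i' where "i = Suc i'" by (cases i) auto
  then show ?case
    using 0 parent_layer[of x i'] by (intro exI[of _ "[parent x]"]) (auto simp: is_path_def)
next
  case (Suc j)
  then obtain i' where i: "i = Suc i'" "j < i'" by (cases i) auto
  then obtain i'' where i': "i' = Suc i''" by (cases i') auto
  let ?x = "parent x" and ?y = "parent y"
  have parents_layer: "?x \<in> layer i'" "?y \<in> layer i'" using Suc.prems(1,2) i parent_layer by auto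
  have ancestors: "(parent ^^ j) ?x \<noteq> (parent ^^ j) ?y"
    "(parent ^^ Suc j) ?x = (parent ^^ Suc j) ?y"
    using Suc.prems(4,5) by (simp_all add: funpow_Suc_right del: funpow.simps)
  then obtain ps where ps: "is_path E (\<Union>h<i'. layer h) ps" "hd ps = parent ?x"
    "last ps = parent ?y" "length ps = 2 * j + 1"
    using Suc.IH[OF parents_layer i(2)] by blast
  have below: "?x \<notin> set ps" "?y \<notin> set ps"
    using ps(1) parents_layer layers_disjoint[of i'] by (fastforce simp: is_path_def)+
  have "?x \<noteq> ?y" using ancestors(1) by auto
  have ps_i: "is_path E (\<Union>h<i. layer h) ps" by (rule is_path_mono[OF ps(1)]) (force simp: i)+
  have "is_path E (\<Union>h<i. layer h) [?y]" using parents_layer i by (auto simp: is_path_def)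
  moreover have "E (last ps) (hd [?y])"
    using ps(3) parent_edge[of ?y i''] parents_layer i' sympD[OF symp] by auto
  ultimately have "is_path E (\<Union>h<i. layer h) (ps @ [?y])"
    using is_path_append[OF ps_i] below by simp
  moreover have "E ?x (hd (ps @ [?y]))"
    using ps parent_edge[of ?x i''] parents_layer i' by (auto simp: is_path_def hd_append)
  ultimately have "is_path E (\<Union>h<i. layer h) (?x # ps @ [?y])"
    using parents_layer i below \<open>?x \<noteq> ?y\<close> by (auto simp: is_path_Cons)
  then show ?case using ps(4) by (intro exI[of _ "?x # ps @ [?y]"]) simp
qed

lemma layer_pair_disjoint: "Y = layer i \<or> Y = layer (Suc i) \<Longrightarrow> layer i = Y \<or> layer i \<inter> Y = {}"
  using layers_disjoint[of i "Suc i"] by auto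

lemma close_path_through_tree:
  assumes "x \<in> layer i" "y \<in> layer i" "j < i"
    and "(parent ^^ j) x \<noteq> (parent ^^ j) y" "(parent ^^ Suc j) x = (parent ^^ Suc j) y"
    and ps: "is_path E (layer i \<union> layer (Suc i)) ps" "hd ps = x" "last ps = y"
  shows "has_cycle E V (length ps + (2 * j + 1))"
proof -
  obtain qs where qs: "is_path E (\<Union>h<i. layer h) qs" "hd qs = parent y" "last qs = parent x"
    "length qs = 2 * j + 1"
    using tree_path[OF assms(2,1,3)] assms(4,5) by metis
  have "layer h \<inter> (layer i \<union> layer (Suc i)) = {}" if "h < i" for h
    using layers_disjoint[of h i] layers_disjoint[of h "Suc i"] that by auto
  then have "set ps \<inter> set qs = {}" using ps(1) qs(1) by (fastforce simp: is_path_def)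
  moreover have "is_path E V ps" "is_path E V qs"
    using layer_subset by (blast intro: is_path_mono[OF ps(1)] is_path_mono[OF qs(1)])+
  moreover have "E x (parent x)" "E y (parent y)"
    using assms(1-3) parent_edge[of _ "i - 1"] by auto
  ultimately have "is_path E V (ps @ qs)" "E (last (ps @ qs)) (hd (ps @ qs))"
    using ps(2,3) qs(2,3) sympD[OF symp] by (auto intro!: is_path_append) (auto simp: is_path_def)
  then show ?thesis unfolding has_cycle_def using qs(4) by (intro exI[of _ "ps @ qs"]) simp
qed

lemma close_path_through_siblings:
  assumes Y: "Y = layer i \<or> Y = layer (Suc i)" and W: "W \<subseteq> layer i \<union> Y" and w: "w \<in> W \<inter> Y"
    and c: "c \<in> neighbours (between E (layer i) Y) W w" and "j < i"
    and ps: "is_path (between E (layer i) Y) (W - {w, c}) ps" "last ps \<in> layer i"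
      "hd ps \<in> neighbours (between E (layer i) Y) W w"
    and ancestors: "(parent ^^ j) c \<noteq> (parent ^^ j) (last ps)"
      "(parent ^^ Suc j) c = (parent ^^ Suc j) (last ps)"
  shows "has_cycle E V (length ps + 2 * j + 3)"
proof -
  have W_layers: "W \<subseteq> layer i \<union> layer (Suc i)" using W Y by auto
  have "c \<in> layer i" "c \<in> W"
    using c w neighbours_between_subset[OF _ layer_pair_disjoint[OF Y]]
    by (auto simp: neighbours_def)
  moreover have "E c w" "E w (hd ps)"
    using c ps(3) sympD[OF symp] by (auto simp: neighbours_def between_def)
  moreover have "is_path E (layer i \<union> layer (Suc i)) ps"
    by (rule is_path_mono[OF ps(1)]) (use W_layers in \<open>auto simp: between_def\<close>)
  moreover have "set ps \<inter> {w, c} = {}" using ps(1) by (auto simp: is_path_def)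
  ultimately have "is_path E (layer i \<union> layer (Suc i)) (c # w # ps)"
    using w W_layers irreflpD[OF irreflp] by (auto simp: is_path_Cons)
  moreover have "last (c # w # ps) = last ps" using ps(1) by (simp add: is_path_def)
  ultimately have "has_cycle E V (length (c # w # ps) + (2 * j + 1))"
    using close_path_through_tree[of c i "last ps" j "c # w # ps"] \<open>c \<in> layer i\<close> ps(2) ancestors
      \<open>j < i\<close> by simp
  then show ?thesis by (simp add: eval_nat_numeral)
qed

text \<open>From a third neighbour \<open>z\<close> of \<open>w\<close> walk an even path that avoids \<open>w, a, b\<close>. The \<open>(j+1)\<close>-st
  ancestor of its end is that of \<open>a\<close> and \<open>b\<close>, while its \<open>j\<close>-th ancestor differs from that of one
  of the two. The tree path between these two vertices closes the cycle.\<close>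

lemma has_cycle_of_separated_siblings:
  assumes Y: "Y = layer i \<or> Y = layer (Suc i)" and W: "W \<subseteq> layer i \<union> Y"
    and deg: "\<And>w. w \<in> W \<Longrightarrow> 2 * k + 2 < deg (between E (layer i) Y) W w"
    and ij: "j < i" "i < k"
    and separated: "\<not> siblings_agree (between E (layer i) Y) W Y (parent ^^ j)"
    and agree: "siblings_agree (between E (layer i) Y) W Y (parent ^^ Suc j)"
  shows "has_cycle E V (2 * k)"
proof -
  let ?H = "between E (layer i) Y"
  obtain w a b where w: "w \<in> W \<inter> Y"
    and ab: "a \<in> neighbours ?H W w" "b \<in> neighbours ?H W w" "(parent ^^ j) a \<noteq> (parent ^^ j) b"
    using separated by (auto simp: siblings_agree_def)
  have "finite W" using W Y finite_layer by (meson finite_UnI finite_subset)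
  have card_wab: "card {w, a, b} \<le> 3" by (simp add: card_insert_if)
  then have "\<not> neighbours ?H W w \<subseteq> {w, a, b}"
    using card_mono[of "{w, a, b}" "neighbours ?H W w"] deg[of w] w ij by fastforce
  then obtain z where z: "z \<in> neighbours ?H W w" "z \<in> W - {w, a, b}"
    by (auto simp: neighbours_def)
  note XY = layer_pair_disjoint[OF Y]
  have "z \<in> layer i" using z(1) w neighbours_between_subset[OF _ XY] by blast
  define n where "n = k - (j + 2)"
  have k: "k = j + 2 + n" using ij by (simp add: n_def)
  then obtain ps where ps: "is_path ?H (W - {w, a, b}) ps" "hd ps = z" "length ps = 2 * n + 1"
    and last_ps: "last ps \<in> layer i" "(parent ^^ Suc j) (last ps) = (parent ^^ Suc j) z"
    using even_path_avoiding[OF symp irreflp XY \<open>finite W\<close> less_imp_le[OF deg] agree z(2)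
      \<open>z \<in> layer i\<close>, of n] card_wab by auto
  obtain c where c: "c \<in> neighbours ?H W w" "c \<in> {a, b}"
    and c_separated: "(parent ^^ j) c \<noteq> (parent ^^ j) (last ps)"
    using ab by (metis insertCI)
  have "(parent ^^ Suc j) c = (parent ^^ Suc j) (last ps)"
    using agree w c(1) z(1) last_ps(2) unfolding siblings_agree_def by metis
  moreover have "is_path ?H (W - {w, c}) ps"
    by (rule is_path_mono[OF ps(1)]) (use c(2) in auto)
  ultimately have "has_cycle E V (length ps + 2 * j + 3)"
    using close_path_through_siblings[OF Y W w c(1) ij(1)] last_ps(1) ps(2) z(1) c_separated
    by blast
  moreover have "length ps + 2 * j + 3 = 2 * k" using ps(3) k by simp
  ultimately show ?thesis by metis
qed

text \<open>Take \<open>j\<close> maximal such that two neighbours of a common vertex have distinct \<open>j\<close>-th ancestors.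
  As this works within a layer as well, the host need not be bipartite.\<close>

lemma layer_pair_degenerate:
  assumes "\<not> has_cycle E V (2 * k)" "i < k" and Y: "Y = layer i \<or> Y = layer (Suc i)"
  shows "degenerate (between E (layer i) Y) (layer i \<union> Y) (2 * k + 2)"
proof (rule degenerateI)
  let ?H = "between E (layer i) Y"
  fix W assume W: "W \<subseteq> layer i \<union> Y" "W \<noteq> {}"
    and deg: "\<And>w. w \<in> W \<Longrightarrow> 2 * k + 2 < deg ?H W w"
  let ?agree = "\<lambda>j. siblings_agree ?H W Y (parent ^^ j)"
  have "?agree i"
    unfolding siblings_agree_def
    using neighbours_between_subset[OF _ layer_pair_disjoint[OF Y]] ancestor_root
    by (metis IntD2 subsetD)
  moreover have "\<not> ?agree 0"
  proof
    assume "?agree 0"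
    obtain u where "u \<in> W" using W(2) by blast
    moreover have "neighbours ?H W u \<noteq> {}" using deg[OF \<open>u \<in> W\<close>] by force
    ultimately obtain w where w: "w \<in> W \<inter> Y"
      by (auto simp: neighbours_def between_def)
    then have "card (neighbours ?H W w) \<le> card {SOME a. a \<in> neighbours ?H W w}"
      using \<open>?agree 0\<close> unfolding siblings_agree_def by (intro card_mono) (auto intro: someI2)
    then show False using deg[of w] w by simp
  qed
  ultimately obtain j where "j < i" "\<not> ?agree j" "?agree (Suc j)"
    using ex_least_nat_less[of ?agree i] by blast
  from has_cycle_of_separated_siblings[OF Y W(1) deg this(1) assms(2) this(2,3)]
  show False using assms(1) by contradiction
qed

lemma card_arcs_layer_pair:
  assumes "\<not> has_cycle E V (2 * k)" "i < k" and Y: "Y = layer i \<or> Y = layer (Suc i)"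
  shows "card (arcs E (layer i) Y) \<le> 4 * (k + 1) * (card (layer i) + card Y)"
proof -
  let ?U = "layer i \<union> Y" and ?H = "between E (layer i) Y"
  have "finite ?U" using Y finite_layer by auto
  then have "card (arcs E (layer i) Y) \<le> card (arcs ?H ?U ?U)"
    by (intro card_mono finite_arcs) (auto simp: arcs_def between_def)
  also have "\<dots> \<le> 2 * (2 * k + 2) * card ?U"
    using card_arcs_degenerate[OF \<open>finite ?U\<close> symp_between[OF symp]] layer_pair_degenerate[OF assms]
    by blast
  also have "\<dots> \<le> 2 * (2 * k + 2) * (card (layer i) + card Y)"
    by (intro mult_left_mono card_Un_le) simp
  finally show ?thesis by (simp add: algebra_simps)
qed

lemma layer_growth:
  assumes no_cycle: "\<not> has_cycle E V (2 * k)" and q: "q \<ge> 1"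
    and deg: "\<And>v. v \<in> V \<Longrightarrow> 4 * (k + 1) * (q + 5) \<le> deg E V v"
  shows "i < k \<Longrightarrow> q * card (layer i) \<le> card (layer (Suc i))"
proof (induction i)
  case 0
  have "q \<le> 4 * (k + 1) * (q + 5)" by (simp add: algebra_simps)
  also have "\<dots> \<le> deg E V root" by (rule deg[OF root])
  also have "\<dots> \<le> card (layer 1)" by (intro card_mono finite_layer neighbours_root_subset)
  finally show ?case by (simp add: layer_0)
next
  case (Suc i)
  let ?L = "layer i" and ?M = "layer (Suc i)" and ?N = "layer (Suc (Suc i))"
  have arcs_bounds: "card (arcs E ?M ?L) \<le> 4 * (k + 1) * (card ?L + card ?M)"
    "card (arcs E ?M ?M) \<le> 4 * (k + 1) * (card ?M + card ?M)"
    "card (arcs E ?M ?N) \<le> 4 * (k + 1) * (card ?M + card ?N)"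
    using card_arcs_layer_pair[OF no_cycle, of i ?M] card_arcs_layer_pair[OF no_cycle, of "Suc i"]
      card_arcs_commute[OF symp, of ?M ?L] Suc.prems by auto
  have "4 * (k + 1) * (q + 5) * card ?M \<le> (\<Sum>v\<in>?M. deg E V v)"
    using sum_bounded_below[of ?M "4 * (k + 1) * (q + 5)" "deg E V"] deg layer_subset
    by (auto simp: mult.commute)
  also have "\<dots> = card (arcs E ?M V)" by (rule card_arcs[OF finite_layer finite, symmetric])
  also have "\<dots> \<le> card (arcs E ?M ?L \<union> (arcs E ?M ?M \<union> arcs E ?M ?N))"
  proof (rule card_mono)
    show "arcs E ?M V \<subseteq> arcs E ?M ?L \<union> (arcs E ?M ?M \<union> arcs E ?M ?N)"
      using neighbours_layer_subset[of _ "Suc i"] by (fastforce simp: arcs_eq_Sigma neighbours_def)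
  qed (simp add: finite_layer)
  also have "\<dots> \<le> card (arcs E ?M ?L) + (card (arcs E ?M ?M) + card (arcs E ?M ?N))"
    by (meson add_left_mono card_Un_le order_trans)
  also have "\<dots> \<le> 4 * (k + 1) * (card ?L + 4 * card ?M + card ?N)"
    using add_mono[OF arcs_bounds(1) add_mono[OF arcs_bounds(2,3)]] by (simp add: algebra_simps)
  finally have "4 * (k + 1) * ((q + 5) * card ?M) \<le> 4 * (k + 1) * (card ?L + 4 * card ?M + card ?N)"
    by (simp only: mult.assoc)
  then have "(q + 5) * card ?M \<le> card ?L + 4 * card ?M + card ?N"
    by (subst (asm) mult_le_cancel1) simp
  moreover have "card ?L \<le> card ?M"
    using Suc.IH Suc.prems q order_trans[of "card ?L" "q * card ?L"] by simp
  ultimately show ?case by (simp add: algebra_simps)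
qed

lemma power_le_card:
  assumes "\<not> has_cycle E V (2 * k)" "q \<ge> 1"
    and "\<And>v. v \<in> V \<Longrightarrow> 4 * (k + 1) * (q + 5) \<le> deg E V v"
  shows "q ^ k \<le> card V"
proof -
  have "q ^ i \<le> card (layer i)" if "i \<le> k" for i
    using that
  proof (induction i)
    case (Suc i)
    then have "q * q ^ i \<le> q * card (layer i)" by simp
    also have "\<dots> \<le> card (layer (Suc i))" using layer_growth[OF assms] Suc.prems by simp
    finally show ?case by simp
  qed (simp add: layer_0)
  also have "card (layer k) \<le> card V" using finite layer_subset by (rule card_mono)
  finally show ?thesis by simp
qed

end

lemma even_cycle_free_degenerate:
  assumes E: "symp E" "irreflp E" and V: "finite V" "\<not> has_cycle E V (2 * k)"
    and q: "q \<ge> 1" "card V < q ^ k"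
  shows "degenerate E V (4 * (k + 1) * (q + 5))"
proof (rule degenerateI)
  fix W assume W: "W \<subseteq> V" "W \<noteq> {}"
    and deg: "\<And>w. w \<in> W \<Longrightarrow> 4 * (k + 1) * (q + 5) < deg E W w"
  then obtain root where "root \<in> W" by blast
  then interpret breadth_first_search E W root
    using E finite_subset[OF W(1) V(1)] by unfold_locales
  have "\<not> has_cycle E W (2 * k)" using has_cycle_mono[of E W "2 * k" V E] V(2) W(1) by auto
  then have "q ^ k \<le> card W" using power_le_card q(1) deg less_imp_le by blast
  then show False using card_mono[OF V(1) W(1)] q(2) by simp
qed

lemma ex_nat_above_root:
  fixes n k :: nat
  assumes "n \<ge> 1" "k \<ge> 1"
  shows "\<exists>q. n < q ^ k \<and> real q \<le> real n powr (1 / real k) + 1"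
proof -
  define y where "y = real n powr (1 / real k)"
  define q where "q = nat \<lfloor>y\<rfloor> + 1"
  have "y \<ge> 0" by (simp add: y_def)
  then have q: "y < real q" "real q \<le> y + 1" unfolding q_def by linarith+
  have "real n = y ^ k"
    unfolding y_def using assms by (simp add: powr_powr flip: powr_realpow)
  also have "\<dots> < real q ^ k"
    using power_strict_mono[OF q(1) \<open>y \<ge> 0\<close>] assms(2) by simp
  finally have "n < q ^ k" by (metis of_nat_less_iff of_nat_power)
  then show ?thesis using q(2) by (auto simp: y_def)
qed

theorem even_cycle_free_arcs:
  assumes E: "symp E" "irreflp E" and V: "finite V" "\<not> has_cycle E V (2 * k)" and k: "k \<ge> 1"
  shows "real (card (arcs E V V)) \<le> 56 * real (k + 1) * real (card V) powr (1 + 1 / real k)"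
proof (cases "V = {}")
  case True
  then show ?thesis by (simp add: arcs_def)
next
  case False
  let ?n = "card V"
  define y where "y = real ?n powr (1 / real k)"
  have n_pos: "?n \<ge> 1" using False V(1) by (simp add: Suc_le_eq card_gt_0_iff)
  then have "y \<ge> 1" unfolding y_def by (intro ge_one_powr_ge_zero) auto
  obtain q where q: "?n < q ^ k" "real q \<le> y + 1"
    using ex_nat_above_root[OF n_pos k] by (auto simp: y_def)
  have "q \<ge> 1" using q(1) k by (cases q) (auto simp: power_0_left)
  then have "degenerate E V (4 * (k + 1) * (q + 5))"
    using even_cycle_free_degenerate[OF E V _ q(1)] by blast
  then have "card (arcs E V V) \<le> 2 * (4 * (k + 1) * (q + 5)) * ?n"
    by (rule card_arcs_degenerate[OF V(1) E(1)])
  then have "real (card (arcs E V V)) \<le> real (2 * (4 * (k + 1) * (q + 5)) * ?n)"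
    by (simp only: of_nat_le_iff)
  also have "\<dots> = 8 * real (k + 1) * (real q + 5) * real ?n" by simp
  also have "\<dots> \<le> 8 * real (k + 1) * (7 * y) * real ?n"
    using q(2) \<open>y \<ge> 1\<close> by (intro mult_right_mono mult_left_mono) auto
  also have "\<dots> = 56 * real (k + 1) * (real ?n powr 1 * y)" using n_pos by simp
  also have "real ?n powr 1 * y = real ?n powr (1 + 1 / real k)"
    unfolding y_def by (simp add: powr_add)
  finally show ?thesis .
qed

section \<open>Odd cycles\<close>

definition triangle_edge :: "('a \<Rightarrow> 'a \<Rightarrow> bool) \<Rightarrow> 'a set \<Rightarrow> 'a \<Rightarrow> 'a \<Rightarrow> bool" where
  "triangle_edge E V u v \<longleftrightarrow> E u v \<and> (\<exists>w\<in>V. E u w \<and> E v w)"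

lemma symp_triangle_edge: "symp E \<Longrightarrow> symp (triangle_edge E V)"
  by (auto simp: triangle_edge_def symp_def)

lemma irreflp_triangle_edge: "irreflp E \<Longrightarrow> irreflp (triangle_edge E V)"
  by (auto simp: triangle_edge_def irreflp_def)

lemma has_cycle_triangle_edge_Suc:
  assumes E: "symp E" and A: "A \<subseteq> V" and "has_cycle (triangle_edge E (V - A)) A l"
  shows "has_cycle E V (Suc l)"
proof -
  obtain xs where xs: "is_path (triangle_edge E (V - A)) A xs" "length xs = l"
    and "triangle_edge E (V - A) (last xs) (hd xs)"
    using assms(3) by (auto simp: has_cycle_def)
  then obtain w where w: "w \<in> V - A" "E (last xs) w" "E (hd xs) w"
    by (auto simp: triangle_edge_def)
  have "is_path E V xs" by (rule is_path_mono[OF xs(1) A]) (auto simp: triangle_edge_def)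
  then show ?thesis
    using has_cycle_Suc[of E V xs w] xs w sympD[OF E] by (auto simp: is_path_def)
qed

lemma card_subsets_containing_avoiding:
  assumes "finite V" "X \<subseteq> V" "Y \<subseteq> V" "X \<inter> Y = {}"
  shows "card {A \<in> Pow V. X \<subseteq> A \<and> A \<inter> Y = {}} * 2 ^ card (X \<union> Y) = 2 ^ card V"
proof -
  have "bij_betw (\<lambda>A. A \<union> X) (Pow (V - (X \<union> Y))) {A \<in> Pow V. X \<subseteq> A \<and> A \<inter> Y = {}}"
    by (rule bij_betw_byWitness[where f' = "\<lambda>A. A - X"]) (use assms in auto)
  then have "card {A \<in> Pow V. X \<subseteq> A \<and> A \<inter> Y = {}} = card (Pow (V - (X \<union> Y)))"
    by (rule bij_betw_same_card[symmetric])
  also have "\<dots> = 2 ^ (card V - card (X \<union> Y))"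
    using assms by (subst card_Pow) (auto simp: card_Diff_subset finite_subset)
  finally show ?thesis
    using assms card_mono[of V "X \<union> Y"] by (simp flip: power_add)
qed

lemma double_counting_le:
  fixes c :: nat and b :: real
  assumes fin: "finite T" "finite I" "I \<noteq> {}"
    and row_ge: "\<And>t. t \<in> T \<Longrightarrow> card I \<le> c * card {i \<in> I. R t i}"
    and column_le: "\<And>i. i \<in> I \<Longrightarrow> real (card {t \<in> T. R t i}) \<le> b"
  shows "real (card T) \<le> real c * b"
proof -
  have "card I * card T \<le> c * (\<Sum>t\<in>T. card {i \<in> I. R t i})"
    using sum_mono[OF row_ge, of T "\<lambda>t. t"] by (simp add: sum_distrib_left mult.commute)
  also have "(\<Sum>t\<in>T. card {i \<in> I. R t i}) = (\<Sum>i\<in>I. card {t \<in> T. R t i})"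
    by (rule sum_multicount_gen[OF fin(1,2)]) simp
  finally have "real (card I * card T) \<le> real (c * (\<Sum>i\<in>I. card {t \<in> T. R t i}))"
    by (simp only: of_nat_le_iff)
  also have "\<dots> \<le> real c * (\<Sum>i\<in>I. b)"
    unfolding of_nat_mult of_nat_sum by (intro mult_left_mono sum_mono column_le) auto
  finally have "real (card I) * real (card T) \<le> real (card I) * (real c * b)"
    by (simp add: mult.left_commute)
  then show ?thesis using fin by (simp add: card_gt_0_iff)
qed

text \<open>For any vertex set \<open>A\<close>, the edges inside \<open>A\<close> that have a common neighbour outside \<open>A\<close> form
  a \<open>C\<^bsub>2k\<^esub>\<close>-free graph, and a random \<open>A\<close> catches each edge of a triangle with probability at
  least \<open>1/8\<close>.\<close>

lemma odd_cycle_free_triangle_arcs: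
  assumes E: "symp E" "irreflp E" and V: "finite V" "\<not> has_cycle E V (2 * k + 1)" and k: "k \<ge> 1"
  shows "real (card (arcs (triangle_edge E V) V V))
    \<le> 448 * real (k + 1) * real (card V) powr (1 + 1 / real k)"
proof -
  let ?T = "arcs (triangle_edge E V) V V"
  let ?caught = "\<lambda>A. arcs (triangle_edge E (V - A)) A A"
  let ?b = "56 * real (k + 1) * real (card V) powr (1 + 1 / real k)"
  have "real (card ?T) \<le> real 8 * ?b"
  proof (rule double_counting_le)
    show "card (Pow V) \<le> 8 * card {A \<in> Pow V. a \<in> ?caught A}" if "a \<in> ?T" for a
    proof -
      obtain u v w where a: "a = (u, v)" "{u, v, w} \<subseteq> V" "E u v" "E u w" "E v w"
        using \<open>a \<in> ?T\<close> by (auto simp: arcs_def triangle_edge_def)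
      have distinct: "u \<noteq> v" "u \<noteq> w" "v \<noteq> w" using a irreflpD[OF E(2)] by auto
      have "card (Pow V) = 8 * card {A \<in> Pow V. {u, v} \<subseteq> A \<and> A \<inter> {w} = {}}"
        using card_subsets_containing_avoiding[OF V(1), of "{u, v}" "{w}"] a distinct V(1)
        by (simp add: card_Pow mult.commute)
      also have "\<dots> \<le> 8 * card {A \<in> Pow V. a \<in> ?caught A}"
        using a V(1) by (intro mult_left_mono card_mono) (auto simp: arcs_def triangle_edge_def)
      finally show ?thesis .
    qed
    show "real (card {a \<in> ?T. a \<in> ?caught A}) \<le> ?b" if "A \<in> Pow V" for A
    proof -
      have A: "A \<subseteq> V" "finite A" using that V(1) finite_subset by auto
      have "real (card {a \<in> ?T. a \<in> ?caught A}) \<le> real (card (?caught A))"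
        using A(2) by (intro of_nat_mono card_mono finite_arcs) auto
      also have "\<dots> \<le> 56 * real (k + 1) * real (card A) powr (1 + 1 / real k)"
        using V(2) has_cycle_triangle_edge_Suc[OF E(1) A(1)]
        by (intro even_cycle_free_arcs symp_triangle_edge irreflp_triangle_edge E A k) auto
      also have "\<dots> \<le> ?b"
        using card_mono[OF V(1) A(1)] by (intro mult_left_mono powr_mono2) auto
      finally show ?thesis .
    qed
  qed (use V(1) in auto)
  then show ?thesis by (simp add: algebra_simps)
qed

section \<open>Counting cliques\<close>

lemma card_cliques_Suc_le_sum:
  assumes V: "finite V" and M: "\<And>v. v \<in> V \<Longrightarrow> M v \<subseteq> V"
    and cover: "\<And>S. S \<in> cliques E V (Suc q) \<Longrightarrow> \<exists>v\<in>S. S - {v} \<subseteq> M v"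
  shows "card (cliques E V (Suc q)) \<le> (\<Sum>v\<in>V. card (cliques E (M v) q))"
proof -
  have fin: "finite (cliques E (M v) q)" if "v \<in> V" for v
    using M[OF that] V by (meson finite_cliques finite_subset)
  have "S \<in> (\<Union>v\<in>V. insert v ` cliques E (M v) q)" if S: "S \<in> cliques E V (Suc q)" for S
  proof -
    obtain v where v: "v \<in> S" "S - {v} \<subseteq> M v" using cover[OF S] by blast
    have "S - {v} \<in> cliques E (M v) q" "v \<in> V" using S v by (auto simp: cliques_def)
    moreover have "S = insert v (S - {v})" using v by auto
    ultimately show ?thesis by blast
  qed
  then have "card (cliques E V (Suc q)) \<le> card (\<Union>v\<in>V. insert v ` cliques E (M v) q)"
    using V fin by (intro card_mono) auto
  also have "\<dots> \<le> (\<Sum>v\<in>V. card (insert v ` cliques E (M v) q))" by (rule card_UN_le[OF V])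
  also have "\<dots> \<le> (\<Sum>v\<in>V. card (cliques E (M v) q))"
    using fin by (intro sum_mono card_image_le)
  finally show ?thesis .
qed

lemma card_cliques_Suc_le_sum_neighbours:
  assumes "finite V"
  shows "card (cliques E V (Suc q)) \<le> (\<Sum>v\<in>V. card (cliques E (neighbours E V v) q))"
proof (rule card_cliques_Suc_le_sum[OF assms neighbours_subset])
  fix S assume S: "S \<in> cliques E V (Suc q)"
  then obtain v where "v \<in> S" by (force simp: cliques_def)
  with S show "\<exists>v\<in>S. S - {v} \<subseteq> neighbours E V v"
    by (intro bexI[of _ v]) (auto simp: cliques_def neighbours_def)
qed

lemma cycle_free_neighbours_degenerate:
  assumes E: "symp E" "irreflp E" and V: "finite V" "\<not> has_cycle E V l"
    and l: "l \<ge> 2" and v: "v \<in> V"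
  shows "degenerate E (neighbours E V v) l"
proof (rule degenerateI)
  fix W assume W: "W \<subseteq> neighbours E V v" "W \<noteq> {}" and deg: "\<And>w. w \<in> W \<Longrightarrow> l < deg E W w"
  have "finite W" using W(1) V(1) by (meson finite_neighbours finite_subset)
  obtain x where "x \<in> W" using W(2) by blast
  then obtain xs where xs: "is_path E W xs" "length xs = Suc (l - 2)"
    using greedy_path[OF \<open>finite W\<close> less_imp_le[OF deg] E(2), of "{}" x "l - 2"] by auto
  have W_adj: "E v w" "E w v" "w \<noteq> v" if "w \<in> W" for w
    using that W(1) sympD[OF E(1)] irreflpD[OF E(2)] by (auto simp: neighbours_def)
  have "hd xs \<in> W" "last xs \<in> W" "v \<notin> set xs" using xs(1) W_adj by (auto simp: is_path_def)
  moreover have "is_path E V xs"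
    using W(1) neighbours_subset[of E V v] by (intro is_path_mono[OF xs(1)]) auto
  ultimately have "has_cycle E V (Suc (length xs))"
    using v W_adj by (intro has_cycle_Suc[of _ _ _ v]) auto
  moreover have "Suc (length xs) = l" using l xs(2) by simp
  ultimately show False using V(2) by simp
qed

lemma cycle_free_card_cliques:
  assumes E: "symp E" "irreflp E" and V: "finite V" "\<not> has_cycle E V l"
    and l: "l \<ge> 2" and r: "r \<ge> 2"
  shows "card (cliques E V r) \<le> 2 ^ l * card (arcs E V V)"
proof -
  obtain q where r_eq: "r = Suc q" "q \<ge> 1" using r by (cases r) auto
  have "card (cliques E V r) \<le> (\<Sum>v\<in>V. card (cliques E (neighbours E V v) q))"
    unfolding r_eq(1) by (rule card_cliques_Suc_le_sum_neighbours[OF V(1)])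
  also have "\<dots> \<le> (\<Sum>v\<in>V. 2 ^ l * deg E V v)"
    using V(1) r_eq(2) cycle_free_neighbours_degenerate[OF E V l]
    by (intro sum_mono card_cliques_degenerate) auto
  also have "\<dots> = 2 ^ l * card (arcs E V V)" using V(1) by (simp add: card_arcs sum_distrib_left)
  finally show ?thesis .
qed

lemma cliques_subset_triangle_cliques:
  assumes "r \<ge> 3"
  shows "cliques E V r \<subseteq> cliques (triangle_edge E V) V r"
proof
  fix S assume S: "S \<in> cliques E V r"
  have "triangle_edge E V x y" if xy: "x \<in> S" "y \<in> S" "x \<noteq> y" for x y
  proof -
    have "\<not> S \<subseteq> {x, y}"
      using card_mono[of "{x, y}" S] S assms xy by (auto simp: cliques_def)
    then obtain z where z: "z \<in> S" "z \<noteq> x" "z \<noteq> y" by blast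
    then have "z \<in> V" "E x y" "E x z" "E y z" using S xy by (auto simp: cliques_def)
    then show ?thesis by (auto simp: triangle_edge_def)
  qed
  then show "S \<in> cliques (triangle_edge E V) V r" using S by (auto simp: cliques_def)
qed

definition clique_const :: "nat \<Rightarrow> real" where
  "clique_const l = 2 ^ l * (448 * real (l div 2 + 1))"

lemma clique_const_nonneg: "clique_const l \<ge> 0"
  by (simp add: clique_const_def)

lemma cycle_free_cliques_powr:
  assumes E: "symp E" "irreflp E" and V: "finite V" "\<not> has_cycle E V l"
    and l: "l \<ge> 2" and r: "r \<ge> 2 + l mod 2"
  shows "real (card (cliques E V r)) \<le> clique_const l * real (card V) powr (1 + 1 / real (l div 2))"
proof -
  define k where "k = l div 2"
  have k: "k \<ge> 1" using l by (simp add: k_def)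
  let ?b = "448 * real (k + 1) * real (card V) powr (1 + 1 / real k)"
  obtain E' where E': "symp E'" "irreflp E'" "\<not> has_cycle E' V l"
    and cliques_subset: "cliques E V r \<subseteq> cliques E' V r"
    and arcs_le: "real (card (arcs E' V V)) \<le> ?b"
  proof (cases "even l")
    case True
    then have "\<not> has_cycle E V (2 * k)" using V(2) by (simp add: k_def)
    then have "real (card (arcs E V V)) \<le> 56 * real (k + 1) * real (card V) powr (1 + 1 / real k)"
      by (rule even_cycle_free_arcs[OF E V(1) _ k])
    also have "\<dots> \<le> ?b" by (intro mult_right_mono) auto
    finally show ?thesis using that[of E] E V(2) by blast
  next
    case False
    have "\<not> has_cycle E V (2 * k + 1)" using V(2) False by (simp add: k_def)
    then have "real (card (arcs (triangle_edge E V) V V)) \<le> ?b"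
      by (rule odd_cycle_free_triangle_arcs[OF E V(1) _ k])
    moreover have "\<not> has_cycle (triangle_edge E V) V l"
      using has_cycle_mono[of "triangle_edge E V" V l V E] V(2) by (auto simp: triangle_edge_def)
    moreover have "r \<ge> 3" using r False by (simp add: odd_iff_mod_2_eq_one)
    ultimately show ?thesis
      using that symp_triangle_edge[OF E(1)] irreflp_triangle_edge[OF E(2)]
        cliques_subset_triangle_cliques by blast
  qed
  have "card (cliques E V r) \<le> card (cliques E' V r)"
    using cliques_subset V(1) by (intro card_mono) auto
  also have "\<dots> \<le> 2 ^ l * card (arcs E' V V)"
    using r by (intro cycle_free_card_cliques E' V l) auto
  finally have "real (card (cliques E V r)) \<le> real (2 ^ l * card (arcs E' V V))"
    by (simp only: of_nat_le_iff)
  also have "\<dots> \<le> 2 ^ l * ?b" using arcs_le by simp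
  finally show ?thesis by (simp add: clique_const_def k_def mult.assoc)
qed

definition has_clique_join_cycle :: "('a \<Rightarrow> 'a \<Rightarrow> bool) \<Rightarrow> 'a set \<Rightarrow> nat \<Rightarrow> nat \<Rightarrow> bool" where
  "has_clique_join_cycle E V s l \<longleftrightarrow> (\<exists>S\<in>cliques E V s. has_cycle E {v \<in> V. \<forall>x\<in>S. E x v} l)"

lemma has_clique_join_cycle_mono:
  assumes "has_clique_join_cycle E W s l" "W \<subseteq> V"
  shows "has_clique_join_cycle E V s l"
proof -
  obtain S where "S \<in> cliques E W s" and cycle: "has_cycle E {v \<in> W. \<forall>x\<in>S. E x v} l"
    using assms(1) by (auto simp: has_clique_join_cycle_def)
  then have "S \<in> cliques E V s" using assms(2) by (auto simp: cliques_def)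
  moreover have "has_cycle E {v \<in> V. \<forall>x\<in>S. E x v} l"
    using assms(2) by (intro has_cycle_mono[OF cycle]) auto
  ultimately show ?thesis by (auto simp: has_clique_join_cycle_def)
qed

lemma has_clique_join_cycle_Suc:
  assumes E: "symp E" "irreflp E" and V: "finite V" "v \<in> V"
    and "has_clique_join_cycle E (neighbours E V v) s l"
  shows "has_clique_join_cycle E V (Suc s) l"
proof -
  obtain S where S: "S \<in> cliques E (neighbours E V v) s"
    and cycle: "has_cycle E {u \<in> neighbours E V v. \<forall>x\<in>S. E x u} l"
    using assms(5) by (auto simp: has_clique_join_cycle_def)
  have "S \<subseteq> neighbours E V v" using S by (simp add: cliques_def)
  then have "v \<notin> S" "finite S" "\<forall>x\<in>S. E v x \<and> E x v"
    using V(1) sympD[OF E(1)] irreflpD[OF E(2)] by (auto simp: neighbours_def intro: finite_subset)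
  then have insert_clique: "insert v S \<in> cliques E V (Suc s)"
    using S V(2) by (auto simp: cliques_def neighbours_def)
  have "{u \<in> neighbours E V v. \<forall>x\<in>S. E x u} = {u \<in> V. \<forall>x\<in>insert v S. E x u}"
    by (auto simp: neighbours_def)
  then show ?thesis using cycle insert_clique unfolding has_clique_join_cycle_def by metis
qed

lemma clique_join_cycle_free_cliques_powr:
  assumes E: "symp E" "irreflp E" and V: "finite V" "\<not> has_clique_join_cycle E V s l"
    and l: "l \<ge> 2" and r: "r \<ge> s + 2 + l mod 2"
  shows "real (card (cliques E V r))
    \<le> clique_const l * real (card V) powr (real s + 1 + 1 / real (l div 2))"
  using V r
proof (induction s arbitrary: V r)
  case 0
  have "{} \<in> cliques E V 0" by (simp add: cliques_def)
  then have "\<not> has_cycle E V l" using 0(2) by (auto simp: has_clique_join_cycle_def)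
  then show ?case using cycle_free_cliques_powr[OF E 0(1) _ l] 0(3) by simp
next
  case (Suc s)
  let ?\<alpha> = "real s + 1 + 1 / real (l div 2)"
  obtain q where r_eq: "r = Suc q" using Suc.prems(3) by (cases r) auto
  have neighbours_le: "real (card (cliques E (neighbours E V v) q))
      \<le> clique_const l * real (card V) powr ?\<alpha>" if v: "v \<in> V" for v
  proof -
    have "\<not> has_clique_join_cycle E (neighbours E V v) s l"
      using Suc.prems(2) has_clique_join_cycle_Suc[OF E Suc.prems(1) v] by blast
    then have "real (card (cliques E (neighbours E V v) q))
        \<le> clique_const l * real (deg E V v) powr ?\<alpha>"
      using Suc.prems r_eq by (intro Suc.IH) auto
    also have "\<dots> \<le> clique_const l * real (card V) powr ?\<alpha>"
      using clique_const_nonneg card_mono[OF Suc.prems(1) neighbours_subset]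
      by (intro mult_left_mono powr_mono2) auto
    finally show ?thesis .
  qed
  have "card (cliques E V r) \<le> (\<Sum>v\<in>V. card (cliques E (neighbours E V v) q))"
    unfolding r_eq by (rule card_cliques_Suc_le_sum_neighbours[OF Suc.prems(1)])
  then have "real (card (cliques E V r)) \<le> (\<Sum>v\<in>V. real (card (cliques E (neighbours E V v) q)))"
    by (simp flip: of_nat_sum)
  also have "\<dots> \<le> real (card V) * (clique_const l * real (card V) powr ?\<alpha>)"
    by (rule sum_bounded_above[OF neighbours_le])
  also have "\<dots> = clique_const l * (real (card V) powr 1 * real (card V) powr ?\<alpha>)"
    by simp
  also have "\<dots> = clique_const l * real (card V) powr (real (Suc s) + 1 + 1 / real (l div 2))"
    unfolding powr_add[symmetric] by (simp add: algebra_simps)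
  finally show ?case .
qed

definition upper_neighbours :: "('a \<Rightarrow> 'a \<Rightarrow> bool) \<Rightarrow> 'a set \<Rightarrow> 'a \<Rightarrow> 'a set" where
  "upper_neighbours E V v = {u \<in> neighbours E V v. deg E V v \<le> deg E V u}"

lemma upper_neighbours_subset: "upper_neighbours E V v \<subseteq> neighbours E V v"
  by (auto simp: upper_neighbours_def)

lemma card_upper_neighbours_le:
  assumes "finite V"
  shows "(card (upper_neighbours E V v))\<^sup>2 \<le> card (arcs E V V)"
proof -
  let ?M = "upper_neighbours E V v"
  have card_le: "card ?M \<le> deg E V u" if "u \<in> ?M" for u
  proof -
    have "card ?M \<le> deg E V v" by (intro card_mono upper_neighbours_subset finite_neighbours assms)
    then show ?thesis using that by (auto simp: upper_neighbours_def)
  qed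
  have "(card ?M)\<^sup>2 \<le> (\<Sum>u\<in>?M. deg E V u)"
    using sum_bounded_below[of ?M "card ?M" "deg E V", OF card_le] by (simp add: power2_eq_square)
  also have "\<dots> \<le> (\<Sum>u\<in>V. deg E V u)"
    using assms by (intro sum_mono2) (auto simp: upper_neighbours_def neighbours_def)
  finally show ?thesis using assms by (simp add: card_arcs)
qed

lemma card_cliques_Suc_le_sum_upper_neighbours:
  assumes V: "finite V"
  shows "card (cliques E V (Suc q)) \<le> (\<Sum>v\<in>V. card (cliques E (upper_neighbours E V v) q))"
proof (rule card_cliques_Suc_le_sum[OF V])
  show "upper_neighbours E V v \<subseteq> V" for v
    by (auto simp: upper_neighbours_def neighbours_def)
  fix S assume S: "S \<in> cliques E V (Suc q)"
  then have "finite S" "S \<noteq> {}" by (auto simp: cliques_def card_ge_0_finite)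
  then obtain v where "v \<in> S" "\<forall>u\<in>S. deg E V v \<le> deg E V u"
    using ex_is_arg_min_if_finite[of S "deg E V"] by (auto simp: is_arg_min_linorder)
  then show "\<exists>v\<in>S. S - {v} \<subseteq> upper_neighbours E V v"
    using S by (intro bexI[of _ v]) (auto simp: cliques_def upper_neighbours_def neighbours_def)
qed

lemma cliques_Suc_le_arcs_powr:
  assumes V: "finite V" and \<alpha>: "\<alpha> \<ge> 1" and C: "C \<ge> 0"
    and neighbours_le: "\<And>v W. v \<in> V \<Longrightarrow> W \<subseteq> neighbours E V v \<Longrightarrow>
      real (card (cliques E W q)) \<le> C * real (card W) powr \<alpha>"
  shows "real (card (cliques E V (Suc q))) \<le> C * real (card (arcs E V V)) powr ((\<alpha> + 1) / 2)"
proof -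
  let ?N = "real (card (arcs E V V))" and ?M = "upper_neighbours E V"
  have upper_le: "real (card (cliques E (?M v) q)) \<le> C * (real (deg E V v) * ?N powr ((\<alpha> - 1) / 2))"
    if v: "v \<in> V" for v
  proof -
    have "(real (card (?M v)))\<^sup>2 \<le> ?N"
      using card_upper_neighbours_le[OF V, of E v] by (simp flip: of_nat_power)
    then have "real (card (?M v)) \<le> ?N powr (1 / 2)"
      by (simp add: powr_half_sqrt real_le_rsqrt)
    then have "real (card (?M v)) powr (\<alpha> - 1) \<le> (?N powr (1 / 2)) powr (\<alpha> - 1)"
      using \<alpha> by (intro powr_mono2) auto
    also have "\<dots> = ?N powr ((\<alpha> - 1) / 2)" by (simp add: powr_powr)
    finally have powr_le: "real (card (?M v)) powr (\<alpha> - 1) \<le> ?N powr ((\<alpha> - 1) / 2)" .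
    have "real (card (cliques E (?M v) q)) \<le> C * real (card (?M v)) powr (1 + (\<alpha> - 1))"
      using neighbours_le[OF v upper_neighbours_subset] by simp
    also have "\<dots> = C * (real (card (?M v)) * real (card (?M v)) powr (\<alpha> - 1))"
      unfolding powr_add by simp
    also have "\<dots> \<le> C * (real (deg E V v) * ?N powr ((\<alpha> - 1) / 2))"
      using C powr_le card_mono[OF finite_neighbours[OF V] upper_neighbours_subset]
      by (intro mult_left_mono mult_mono) auto
    finally show ?thesis .
  qed
  have "real (card (cliques E V (Suc q))) \<le> (\<Sum>v\<in>V. real (card (cliques E (?M v) q)))"
    using card_cliques_Suc_le_sum_upper_neighbours[OF V] by (simp flip: of_nat_sum)
  also have "\<dots> \<le> (\<Sum>v\<in>V. C * (real (deg E V v) * ?N powr ((\<alpha> - 1) / 2)))"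
    by (rule sum_mono[OF upper_le])
  also have "\<dots> = C * ((\<Sum>v\<in>V. real (deg E V v)) * ?N powr ((\<alpha> - 1) / 2))"
    by (simp add: sum_distrib_left sum_distrib_right)
  also have "(\<Sum>v\<in>V. real (deg E V v)) = ?N powr 1"
    using V by (simp add: card_arcs sum_nonneg)
  also have "?N powr 1 * ?N powr ((\<alpha> - 1) / 2) = ?N powr ((\<alpha> + 1) / 2)"
    unfolding powr_add[symmetric] by (simp add: field_simps)
  finally show ?thesis .
qed

lemma cliques_le_card_powr:
  assumes "finite V" "q \<ge> 1"
  shows "real (card (cliques E V q)) \<le> real (card V) powr real q"
proof -
  have "card (cliques E V q) \<le> card {S. S \<subseteq> V \<and> card S = q}"
    using assms(1) by (intro card_mono) (auto simp: cliques_def)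
  also have "\<dots> = card V choose q" by (rule n_subsets[OF assms(1)])
  also have "\<dots> \<le> card V ^ q" by (rule order_trans[OF _ binomial_fact_pow]) simp
  finally have "real (card (cliques E V q)) \<le> real (card V) ^ q"
    by (metis of_nat_le_iff of_nat_power)
  then show ?thesis using assms(2) by (cases "card V = 0") (simp_all add: powr_realpow zero_power)
qed

section \<open>Embeddings and colourings of graphs\<close>

definition adj :: "'a sgraph \<Rightarrow> 'a \<Rightarrow> 'a \<Rightarrow> bool" where
  "adj G u v \<longleftrightarrow> {u, v} \<in> edges G"

lemma symp_adj: "symp (adj G)"
  by (auto simp: symp_def adj_def insert_commute)

lemma simple_graph_iff: "simple_graph G \<longleftrightarrow> finite (verts G) \<and> edges G \<subseteq> nsets (verts G) 2"
  by (auto simp: simple_graph_def nsets_def card_ge_0_finite)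

lemma irreflp_adj: "simple_graph G \<Longrightarrow> irreflp (adj G)"
  by (fastforce simp: simple_graph_def irreflp_def adj_def)

lemma adj_verts: "simple_graph G \<Longrightarrow> adj G u v \<Longrightarrow> u \<in> verts G \<and> v \<in> verts G"
  unfolding simple_graph_def adj_def by blast

lemma finite_edges: "simple_graph G \<Longrightarrow> finite (edges G)"
  by (auto simp: simple_graph_iff intro: finite_subset finite_imp_finite_nsets)

lemma card_arcs_adj_le:
  assumes G: "simple_graph G"
  shows "card (arcs (adj G) (verts G) (verts G)) \<le> 2 * card (edges G)"
proof -
  let ?orient = "\<lambda>e. {(u, v). {u, v} = e}"
  have orient: "finite (?orient e) \<and> card (?orient e) \<le> 2" if "e \<in> edges G" for e
  proof -
    have "card e = 2" using G that by (auto simp: simple_graph_def)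
    then obtain a b where e: "e = {a, b}" by (meson card_2_iff)
    have subset: "?orient e \<subseteq> {(a, b), (b, a)}" unfolding e by (auto simp: doubleton_eq_iff)
    have "card {(a, b), (b, a)} \<le> 2" by (cases "a = b") auto
    then show ?thesis
      using finite_subset[OF subset] card_mono[OF _ subset] by fastforce
  qed
  have "arcs (adj G) (verts G) (verts G) \<subseteq> (\<Union>e\<in>edges G. ?orient e)"
    by (auto simp: arcs_def adj_def)
  then have "card (arcs (adj G) (verts G) (verts G)) \<le> card (\<Union>e\<in>edges G. ?orient e)"
    using orient finite_edges[OF G] by (intro card_mono) auto
  also have "\<dots> \<le> (\<Sum>e\<in>edges G. card (?orient e))" by (rule card_UN_le[OF finite_edges[OF G]])
  also have "\<dots> \<le> (\<Sum>e\<in>edges G. 2)" using orient by (intro sum_mono) blast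
  finally show ?thesis by simp
qed

lemma complete_graph_eq: "complete_graph r = SGraph {..<r} (nsets {..<r} 2)"
  by (auto simp: complete_graph_def nsets_def card_ge_0_finite)

lemma cliques_adj_iff:
  "S \<in> cliques (adj G) V r \<longleftrightarrow> S \<subseteq> V \<and> card S = r \<and> nsets S 2 \<subseteq> edges G"
  by (auto simp: cliques_def adj_def nsets_2_eq)

lemma graph_iso_complete_graph:
  assumes "finite (verts H)"
  shows "graph_iso (complete_graph r) H \<longleftrightarrow> card (verts H) = r \<and> edges H = nsets (verts H) 2"
proof
  assume "graph_iso (complete_graph r) H"
  then obtain f where f: "bij_betw f {..<r} (verts H)" "edges H = (\<lambda>e. f ` e) ` nsets {..<r} 2"
    by (auto simp: graph_iso_def complete_graph_eq)
  then show "card (verts H) = r \<and> edges H = nsets (verts H) 2"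
    using bij_betw_same_card[OF f(1)] bij_betw_nsets[OF f(1), of 2] by (simp add: bij_betw_def)
next
  assume H: "card (verts H) = r \<and> edges H = nsets (verts H) 2"
  then obtain f where f: "bij_betw f {..<r} (verts H)"
    using ex_bij_betw_nat_finite[OF assms] by (auto simp: atLeast0LessThan)
  then have "(\<lambda>e. f ` e) ` nsets {..<r} 2 = nsets (verts H) 2"
    using bij_betw_nsets[OF f, of 2] by (simp add: bij_betw_def)
  then show "graph_iso (complete_graph r) H"
    using f H by (auto simp: graph_iso_def complete_graph_eq)
qed

lemma copies_complete_graph:
  assumes G: "simple_graph G"
  shows "copies (complete_graph r) G = (\<lambda>S. SGraph S (nsets S 2)) ` cliques (adj G) (verts G) r"
proof (intro set_eqI iffI)
  fix H assume "H \<in> copies (complete_graph r) G"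
  then have sub: "subgraph H G" and "graph_iso (complete_graph r) H"
    by (auto simp: copies_def)
  then have "card (verts H) = r" "edges H = nsets (verts H) 2"
    using graph_iso_complete_graph by (auto simp: subgraph_def simple_graph_def)
  then show "H \<in> (\<lambda>S. SGraph S (nsets S 2)) ` cliques (adj G) (verts G) r"
    using sub by (intro image_eqI[of _ _ "verts H"])
      (auto simp: cliques_adj_iff subgraph_def sgraph.expand)
next
  fix H assume "H \<in> (\<lambda>S. SGraph S (nsets S 2)) ` cliques (adj G) (verts G) r"
  then obtain S where S: "S \<in> cliques (adj G) (verts G) r" "H = SGraph S (nsets S 2)" by blast
  then have "finite S" using G by (auto simp: cliques_def simple_graph_def intro: finite_subset)
  then show "H \<in> copies (complete_graph r) G"
    using S by (auto simp: copies_def cliques_adj_iff subgraph_def simple_graph_iff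
      graph_iso_complete_graph)
qed

lemma card_copies_complete_graph:
  assumes "simple_graph G"
  shows "card (copies (complete_graph r) G) = card (cliques (adj G) (verts G) r)"
  by (simp add: copies_complete_graph[OF assms] card_image inj_on_def)

definition embedding :: "'a sgraph \<Rightarrow> 'b sgraph \<Rightarrow> ('a \<Rightarrow> 'b) \<Rightarrow> bool" where
  "embedding F G f \<longleftrightarrow> inj_on f (verts F) \<and> f ` verts F \<subseteq> verts G \<and> (\<forall>e\<in>edges F. f ` e \<in> edges G)"

lemma graph_free_iff_no_embedding:
  assumes F: "simple_graph F" and G: "simple_graph G"
  shows "graph_free F G \<longleftrightarrow> (\<nexists>f. embedding F G f)"
proof
  show "\<nexists>f. embedding F G f" if "graph_free F G"
  proof
    assume "\<exists>f. embedding F G f"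
    then obtain f where f: "embedding F G f" ..
    let ?H = "SGraph (f ` verts F) ((\<lambda>e. f ` e) ` edges F)"
    have "subgraph ?H G"
      using f F G by (fastforce simp: subgraph_def simple_graph_def embedding_def)
    moreover have "graph_iso F ?H"
      using f by (auto simp: graph_iso_def embedding_def bij_betw_def)
    ultimately show False using that by (auto simp: graph_free_def copies_def)
  qed
  show "graph_free F G" if no_embedding: "\<nexists>f. embedding F G f"
  proof (rule ccontr)
    assume "\<not> graph_free F G"
    then obtain H f where "subgraph H G" "bij_betw f (verts F) (verts H)"
      "edges H = (\<lambda>e. f ` e) ` edges F"
      by (auto simp: graph_free_def copies_def graph_iso_def)
    then have "embedding F G f" by (auto simp: embedding_def subgraph_def bij_betw_def)
    then show False using no_embedding by blast
  qed
qed

lemma simple_complete_graph: "simple_graph (complete_graph r)"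
  by (simp add: simple_graph_iff complete_graph_eq)

lemma simple_cycle_graph:
  assumes "l \<ge> 2"
  shows "simple_graph (cycle_graph l)"
proof -
  have "i \<noteq> Suc i mod l" if "i < l" for i
    using assms that by (cases "Suc i = l") auto
  then show ?thesis using assms by (auto simp: simple_graph_iff cycle_graph_def)
qed

lemma verts_graph_join: "verts (graph_join G H) = verts G <+> verts H"
  by (simp add: graph_join_def)

lemma simple_graph_join:
  assumes "simple_graph G" "simple_graph H"
  shows "simple_graph (graph_join G H)"
  using assms by (auto simp: simple_graph_def graph_join_def card_image)

lemma embedding_complete_graph:
  assumes "finite S" "S \<in> cliques (adj G) (verts G) s"
  shows "\<exists>f. embedding (complete_graph s) G f \<and> f ` {..<s} = S"
proof -
  obtain f where f: "bij_betw f {..<s} S"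
    using ex_bij_betw_nat_finite[OF assms(1)] assms(2) by (auto simp: cliques_def atLeast0LessThan)
  then have "(\<lambda>e. f ` e) ` nsets {..<s} 2 \<subseteq> edges G"
    using bij_betw_nsets[OF f, of 2] assms(2) by (simp add: bij_betw_def cliques_adj_iff)
  then show ?thesis
    using f assms(2)
    by (intro exI[of _ f]) (auto simp: embedding_def complete_graph_eq bij_betw_def cliques_def)
qed

lemma embedding_cycle_graph:
  assumes path: "is_path (adj G) (verts G) xs" and closed: "adj G (last xs) (hd xs)"
  shows "embedding (cycle_graph (length xs)) G (nth xs)"
proof -
  have "adj G (xs ! i) (xs ! (Suc i mod length xs))" if "i < length xs" for i
  proof (cases "Suc i = length xs")
    case True
    then have "xs \<noteq> []" "i = length xs - 1" by auto
    then show ?thesis using closed True by (simp add: last_conv_nth hd_conv_nth)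
  next
    case False
    then show ?thesis using path that by (simp add: is_path_def successively_conv_nth)
  qed
  then show ?thesis
    using path by (auto simp: embedding_def cycle_graph_def is_path_def adj_def inj_on_nth)
qed

lemma embedding_graph_join:
  assumes G: "simple_graph G" and f: "embedding F1 G f" and g: "embedding F2 G g"
    and adj: "\<And>u v. u \<in> verts F1 \<Longrightarrow> v \<in> verts F2 \<Longrightarrow> adj G (f u) (g v)"
  shows "embedding (graph_join F1 F2) G (case_sum f g)"
proof -
  have images_disjoint: "f u \<noteq> g v" if "u \<in> verts F1" "v \<in> verts F2" for u v
    using adj[OF that] irreflpD[OF irreflp_adj[OF G], of "g v"] by auto
  have "inj_on (case_sum f g) (verts F1 <+> verts F2)"
    using f g images_disjoint images_disjoint[symmetric]
    by (auto simp: embedding_def inj_on_eq_iff intro!: inj_onI)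
  then show ?thesis
    using f g adj by (auto simp: embedding_def graph_join_def adj_def image_image)
qed

abbreviation clique_join_cycle :: "nat \<Rightarrow> nat \<Rightarrow> (nat + nat) sgraph" where
  "clique_join_cycle s l \<equiv> graph_join (complete_graph s) (cycle_graph l)"

lemma simple_clique_join_cycle: "l \<ge> 2 \<Longrightarrow> simple_graph (clique_join_cycle s l)"
  by (intro simple_graph_join simple_complete_graph simple_cycle_graph)

lemma graph_free_no_clique_join_cycle:
  assumes G: "simple_graph G" and l: "l \<ge> 2"
    and free: "graph_free (clique_join_cycle s l) G"
  shows "\<not> has_clique_join_cycle (adj G) (verts G) s l"
proof
  assume "has_clique_join_cycle (adj G) (verts G) s l"
  then obtain S xs where S: "S \<in> cliques (adj G) (verts G) s"
    and xs: "is_path (adj G) {v \<in> verts G. \<forall>x\<in>S. adj G x v} xs" "adj G (last xs) (hd xs)"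
      "length xs = l"
    by (auto simp: has_clique_join_cycle_def has_cycle_def)
  have "finite S" using S G by (auto simp: cliques_def simple_graph_def intro: finite_subset)
  then obtain f where f: "embedding (complete_graph s) G f" "f ` {..<s} = S"
    using embedding_complete_graph S by blast
  have "is_path (adj G) (verts G) xs" by (rule is_path_mono[OF xs(1)]) auto
  then have g: "embedding (cycle_graph l) G (nth xs)"
    using embedding_cycle_graph xs(2,3) by blast
  have "adj G (f i) (xs ! j)" if "i < s" "j < l" for i j
    using xs(1,3) f(2) that by (auto simp: is_path_def subset_iff)
  then have "embedding (clique_join_cycle s l) G (case_sum f (nth xs))"
    by (intro embedding_graph_join[OF G f(1) g]) (auto simp: complete_graph_def cycle_graph_def)
  then show False
    using free graph_free_iff_no_embedding[OF simple_clique_join_cycle[OF l] G] by blast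
qed

definition colourable :: "nat \<Rightarrow> 'a sgraph \<Rightarrow> bool" where
  "colourable k G \<longleftrightarrow> (\<exists>c :: 'a \<Rightarrow> nat. (\<forall>v\<in>verts G. c v < k) \<and>
    (\<forall>u\<in>verts G. \<forall>v\<in>verts G. adj G u v \<longrightarrow> c u \<noteq> c v))"

lemma colourableI_card:
  assumes "finite (c ` verts G)" "card (c ` verts G) \<le> k"
    and "\<And>u v. u \<in> verts G \<Longrightarrow> v \<in> verts G \<Longrightarrow> adj G u v \<Longrightarrow> c u \<noteq> c v"
  shows "colourable k G"
proof -
  obtain h where h: "bij_betw h (c ` verts G) {0..<card (c ` verts G)}"
    using ex_bij_betw_finite_nat[OF assms(1)] by blast
  have "h (c v) < k" if "v \<in> verts G" for v
    using bij_betwE[OF h] assms(2) that by fastforce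
  moreover have "h (c u) \<noteq> h (c v)" if "u \<in> verts G" "v \<in> verts G" "adj G u v" for u v
    using assms(3)[OF that] that h by (auto simp: bij_betw_def inj_on_eq_iff)
  ultimately show ?thesis unfolding colourable_def by (intro exI[of _ "h \<circ> c"]) auto
qed

lemma colourable_embedding:
  assumes f: "embedding F G f" and "colourable k G"
  shows "colourable k F"
proof -
  obtain c :: "_ \<Rightarrow> nat" where colouring: "\<And>v. v \<in> verts G \<Longrightarrow> c v < k"
    "\<And>u v. u \<in> verts G \<Longrightarrow> v \<in> verts G \<Longrightarrow> adj G u v \<Longrightarrow> c u \<noteq> c v"
    using assms(2) by (auto simp: colourable_def)
  have "f v \<in> verts G" if "v \<in> verts F" for v
    using f that by (auto simp: embedding_def)
  moreover have "adj G (f u) (f v)" if "adj F u v" for u v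
    using f that by (auto simp: embedding_def adj_def dest!: bspec)
  ultimately show ?thesis
    unfolding colourable_def by (intro exI[of _ "c \<circ> f"]) (simp add: colouring)
qed

lemma colourable_graph_join:
  assumes "colourable k (graph_join G H)"
  shows "\<exists>a b. a + b \<le> k \<and> colourable a G \<and> colourable b H"
proof -
  obtain c :: "_ \<Rightarrow> nat" where colouring: "\<forall>x\<in>verts G <+> verts H. c x < k"
    "\<forall>x\<in>verts G <+> verts H. \<forall>y\<in>verts G <+> verts H. adj (graph_join G H) x y \<longrightarrow> c x \<noteq> c y"
    using assms unfolding colourable_def verts_graph_join by blast
  let ?A = "(c \<circ> Inl) ` verts G" and ?B = "(c \<circ> Inr) ` verts H"
  have adj_Inl: "adj (graph_join G H) (Inl u) (Inl v)" if "adj G u v" for u v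
    using that by (auto simp: adj_def graph_join_def intro!: image_eqI[of _ _ "{u, v}"])
  have adj_Inr: "adj (graph_join G H) (Inr u) (Inr v)" if "adj H u v" for u v
    using that by (auto simp: adj_def graph_join_def intro!: image_eqI[of _ _ "{u, v}"])
  have adj_across: "adj (graph_join G H) (Inl u) (Inr v)" if "u \<in> verts G" "v \<in> verts H" for u v
    using that by (auto simp: adj_def graph_join_def)
  have subset: "?A \<union> ?B \<subseteq> {..<k}" using colouring(1) by auto
  then have fin: "finite ?A" "finite ?B" using finite_subset by blast+
  have "?A \<inter> ?B = {}" using colouring(2) adj_across by fastforce
  then have "card ?A + card ?B = card (?A \<union> ?B)" by (rule card_Un_disjoint[OF fin, symmetric])
  also have "\<dots> \<le> k" using card_mono[OF _ subset] by simp
  finally have "card ?A + card ?B \<le> k" .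
  moreover have "colourable (card ?A) G" "colourable (card ?B) H"
    using fin colouring(2) adj_Inl adj_Inr by (fastforce intro!: colourableI_card)+
  ultimately show ?thesis by blast
qed

lemma colourable_complete_graph:
  assumes "colourable k (complete_graph s)"
  shows "s \<le> k"
proof -
  obtain c :: "nat \<Rightarrow> nat" where "\<And>i. i < s \<Longrightarrow> c i < k"
    "\<And>i j. i < s \<Longrightarrow> j < s \<Longrightarrow> i \<noteq> j \<Longrightarrow> c i \<noteq> c j"
    using assms by (auto simp: colourable_def complete_graph_eq adj_def)
  then have "inj_on c {..<s}" "c ` {..<s} \<subseteq> {..<k}" by (auto simp: inj_on_def)
  then show ?thesis using card_inj_on_le[of c "{..<s}" "{..<k}"] by simp
qed

lemma colourable_cycle_graph:
  assumes l: "l \<ge> 2" and "colourable k (cycle_graph l)"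
  shows "2 + l mod 2 \<le> k"
proof -
  obtain c :: "nat \<Rightarrow> nat" where c_less: "\<And>i. i < l \<Longrightarrow> c i < k"
    and c_adj: "\<And>i j. i < l \<Longrightarrow> j < l \<Longrightarrow> adj (cycle_graph l) i j \<Longrightarrow> c i \<noteq> c j"
    using assms(2) by (auto simp: colourable_def cycle_graph_def)
  have c_Suc: "c i \<noteq> c (Suc i mod l)" if "i < l" for i
    using that l by (intro c_adj) (auto simp: adj_def cycle_graph_def)
  have "k \<ge> 2" using c_less[of 0] c_less[of 1] c_Suc[of 0] l by fastforce
  moreover have "k \<noteq> 2" if "odd l"
  proof
    assume "k = 2"
    have "c i = (c 0 + i) mod 2" if "i < l" for i
      using that
    proof (induction i)
      case 0
      then show ?case using c_less \<open>k = 2\<close> by simp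
    next
      case (Suc i)
      then have "c (Suc i) \<noteq> c i" "c (Suc i) < 2" "c i = (c 0 + i) mod 2"
        using c_Suc[of i] c_less \<open>k = 2\<close> by auto
      then show ?case by presburger
    qed
    from this[of "l - 1"] have "c (l - 1) = c 0"
      using \<open>odd l\<close> c_less[of 0] \<open>k = 2\<close> l by (auto elim!: oddE)
    then show False using c_Suc[of "l - 1"] l by simp
  qed
  ultimately show ?thesis by (cases "even l") (auto simp: odd_iff_mod_2_eq_one)
qed

lemma colourable_graph_free_clique_join_cycle:
  assumes G: "simple_graph G" "colourable k G" and l: "l \<ge> 2" and k: "k < s + 2 + l mod 2"
  shows "graph_free (clique_join_cycle s l) G"
proof -
  have "\<not> colourable k (clique_join_cycle s l)"
    using colourable_graph_join colourable_complete_graph colourable_cycle_graph[OF l] k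
    by fastforce
  then have "\<nexists>f. embedding (clique_join_cycle s l) G f" using colourable_embedding G(2) by blast
  then show ?thesis
    using graph_free_iff_no_embedding[OF simple_clique_join_cycle[OF l] G(1)] by blast
qed

section \<open>Multipartite graphs with a prescribed number of edges\<close>

lemma ex_add_disjoint_edge:
  fixes G :: "'a sgraph"
  assumes "infinite (UNIV :: 'a set)" and G: "simple_graph G" "colourable k G" and k: "k \<ge> 2"
  shows "\<exists>G'. simple_graph G' \<and> subgraph G G' \<and> card (edges G') = Suc (card (edges G))
    \<and> colourable k G'"
proof -
  have fin: "finite (verts G)" using G(1) by (simp add: simple_graph_def)
  obtain x where x_fresh: "x \<notin> verts G" using ex_new_if_finite[OF assms(1) fin] by blast
  obtain y where y_fresh: "y \<notin> insert x (verts G)"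
    using ex_new_if_finite[OF assms(1), of "insert x (verts G)"] fin by blast
  obtain c :: "'a \<Rightarrow> nat" where colouring: "\<forall>v\<in>verts G. c v < k"
    "\<forall>u\<in>verts G. \<forall>v\<in>verts G. adj G u v \<longrightarrow> c u \<noteq> c v"
    using G(2) by (auto simp: colourable_def)
  let ?G' = "SGraph (insert x (insert y (verts G))) (insert {x, y} (edges G))"
  have "e \<subseteq> verts G" if "e \<in> edges G" for e using G(1) that by (auto simp: simple_graph_def)
  then have "{x, y} \<notin> edges G" using x_fresh by blast
  then have "card (edges ?G') = Suc (card (edges G))" using finite_edges[OF G(1)] by simp
  moreover have "simple_graph ?G'" using G(1) y_fresh by (auto simp: simple_graph_def)
  moreover have "subgraph G ?G'" using G(1) by (auto simp: subgraph_def)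
  moreover have "colourable k ?G'"
    unfolding colourable_def
  proof (intro exI[of _ "c(x := 0, y := 1)"] conjI ballI impI)
    fix u v assume "adj ?G' u v"
    then have "{u, v} = {x, y} \<or> adj G u v" by (auto simp: adj_def)
    then show "(c(x := 0, y := 1)) u \<noteq> (c(x := 0, y := 1)) v"
      using x_fresh y_fresh colouring(2) adj_verts[OF G(1)] by (auto simp: doubleton_eq_iff)
  qed (use colouring(1) k in auto)
  ultimately show ?thesis by blast
qed

lemma ex_supergraph_card_edges:
  fixes G :: "'a sgraph"
  assumes "infinite (UNIV :: 'a set)" and G: "simple_graph G" "colourable k G" and k: "k \<ge> 2"
    and "card (edges G) \<le> m"
  shows "\<exists>G'. simple_graph G' \<and> subgraph G G' \<and> card (edges G') = m \<and> colourable k G'"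
  using assms(5)
proof (induction m rule: dec_induct)
  case base
  then show ?case using G by (auto simp: subgraph_def)
next
  case (step m)
  then obtain H where H: "simple_graph H" "subgraph G H" "card (edges H) = m" "colourable k H"
    by blast
  obtain H' where "simple_graph H'" "subgraph H H'" "card (edges H') = Suc m" "colourable k H'"
    using ex_add_disjoint_edge[OF assms(1) H(1,4) k] H(3) by auto
  then show ?case using H(2) by (intro exI[of _ H']) (auto simp: subgraph_def)
qed

lemma card_copies_complete_graph_subgraph:
  assumes "subgraph G G'" "simple_graph G'"
  shows "card (copies (complete_graph r) G) \<le> card (copies (complete_graph r) G')"
proof -
  have "finite (copies (complete_graph r) G')"
    using assms(2) by (simp add: copies_complete_graph simple_graph_def)
  moreover have "copies (complete_graph r) G \<subseteq> copies (complete_graph r) G'"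
    using assms(1) by (auto simp: copies_def subgraph_def)
  ultimately show ?thesis by (rule card_mono)
qed

definition balanced_multipartite :: "nat \<Rightarrow> nat \<Rightarrow> nat sgraph" where
  "balanced_multipartite k a = SGraph {..<k * a} {e \<in> nsets {..<k * a} 2. inj_on (\<lambda>v. v mod k) e}"

lemma verts_balanced_multipartite [simp]: "verts (balanced_multipartite k a) = {..<k * a}"
  by (simp add: balanced_multipartite_def)

lemma simple_balanced_multipartite: "simple_graph (balanced_multipartite k a)"
  by (auto simp: balanced_multipartite_def simple_graph_iff)

lemma adj_balanced_multipartite_iff:
  "adj (balanced_multipartite k a) u v \<longleftrightarrow> u < k * a \<and> v < k * a \<and> u mod k \<noteq> v mod k"
  by (auto simp: adj_def balanced_multipartite_def)

lemma colourable_balanced_multipartite: "colourable k (balanced_multipartite k a)"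
  unfolding colourable_def
  by (intro exI[of _ "\<lambda>v. v mod k"])
    (auto simp: adj_balanced_multipartite_iff intro!: mod_less_divisor gr0I)

lemma card_edges_balanced_multipartite_le: "card (edges (balanced_multipartite k a)) \<le> (k * a)\<^sup>2"
proof -
  have "card (edges (balanced_multipartite k a)) \<le> card (nsets {..<k * a} 2)"
    by (intro card_mono finite_imp_finite_nsets) (auto simp: balanced_multipartite_def)
  also have "\<dots> = k * a choose 2" by (simp only: binomial_eq_nsets atLeast0LessThan)
  also have "\<dots> \<le> (k * a)\<^sup>2" by (rule order_trans[OF _ binomial_fact_pow]) simp
  finally show ?thesis .
qed

definition transversal :: "nat \<Rightarrow> (nat \<Rightarrow> nat) \<Rightarrow> nat set" where
  "transversal k f = (\<lambda>i. k * f i + i) ` {..<k}"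

lemma transversal_cliques:
  assumes f: "f \<in> {..<k} \<rightarrow>\<^sub>E {..<a}"
  shows "transversal k f \<in> cliques (adj (balanced_multipartite k a)) {..<k * a} k"
proof -
  have less: "k * f i + i < k * a" if "i < k" for i
  proof -
    have "Suc (f i) \<le> a" using f that by (auto simp: PiE_iff Suc_le_eq)
    then have "k * Suc (f i) \<le> k * a" by (rule mult_le_mono2)
    then show ?thesis using that by simp
  qed
  have "inj_on (\<lambda>i. k * f i + i) {..<k}"
  proof (rule inj_onI)
    fix i j assume "i \<in> {..<k}" "j \<in> {..<k}" "k * f i + i = k * f j + j"
    then have "(k * f i + i) mod k = (k * f j + j) mod k" "i < k" "j < k" by auto
    then show "i = j" by simp
  qed
  then have "card (transversal k f) = k" by (simp add: transversal_def card_image)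
  then show ?thesis
    using less by (auto simp: cliques_def transversal_def adj_balanced_multipartite_iff)
qed

lemma inj_on_transversal: "inj_on (transversal k) ({..<k} \<rightarrow>\<^sub>E {..<a})"
proof (rule inj_onI)
  fix f g assume f: "f \<in> {..<k} \<rightarrow>\<^sub>E {..<a}" and g: "g \<in> {..<k} \<rightarrow>\<^sub>E {..<a}"
    and eq: "transversal k f = transversal k g"
  show "f = g"
  proof (rule PiE_ext[OF f g])
    fix i assume i: "i \<in> {..<k}"
    then obtain j where j: "j < k" "k * f i + i = k * g j + j"
      using eq by (force simp: transversal_def)
    then have "(k * f i + i) mod k = (k * g j + j) mod k" by simp
    then have "i = j" using i j(1) by simp
    then show "f i = g i" using j by simp
  qed
qed

lemma card_copies_balanced_multipartite_ge:
  "a ^ k \<le> card (copies (complete_graph k) (balanced_multipartite k a))"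
proof -
  let ?K = "cliques (adj (balanced_multipartite k a)) {..<k * a} k"
  have "a ^ k = card (transversal k ` ({..<k} \<rightarrow>\<^sub>E {..<a}))"
    by (simp add: card_image[OF inj_on_transversal] card_PiE)
  also have "\<dots> \<le> card ?K" using transversal_cliques by (intro card_mono) auto
  finally show ?thesis
    by (simp add: card_copies_complete_graph simple_balanced_multipartite)
qed

lemma ex_clique_join_cycle_free_graph:
  assumes k: "k \<ge> 2" "k < s + 2 + l mod 2" and l: "l \<ge> 2" and m: "(k * a)\<^sup>2 \<le> m"
  shows "\<exists>G :: nat sgraph. simple_graph G \<and> card (edges G) = m
    \<and> graph_free (clique_join_cycle s l) G
    \<and> a ^ k \<le> card (copies (complete_graph k) G)"
proof -
  let ?B = "balanced_multipartite k a"
  obtain G where G: "simple_graph G" "subgraph ?B G" "card (edges G) = m" "colourable k G"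
    using ex_supergraph_card_edges[OF infinite_UNIV_nat simple_balanced_multipartite
      colourable_balanced_multipartite k(1), of a m] card_edges_balanced_multipartite_le[of k a] m
    by auto
  have "a ^ k \<le> card (copies (complete_graph k) G)"
    using card_copies_balanced_multipartite_ge card_copies_complete_graph_subgraph[OF G(2,1)]
    by (rule order_trans)
  then show ?thesis using G colourable_graph_free_clique_join_cycle[OF G(1,4) l k(2)] by blast
qed

section \<open>Bounds for the number of copies\<close>

lemma
  fixes H :: "'a sgraph" and F :: "'b sgraph" and B :: real
  assumes bound: "\<And>G :: nat sgraph. simple_graph G \<Longrightarrow> card (edges G) = m \<Longrightarrow> graph_free F G \<Longrightarrow>
      real (card (copies H G)) \<le> B"
    and G: "simple_graph (G :: nat sgraph)" "card (edges G) = m" "graph_free F G"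
  shows mex_le: "real (mex m H F) \<le> B"
    and card_copies_le_mex: "card (copies H G) \<le> mex m H F"
proof -
  let ?counts = "{card (copies H G) | G :: nat sgraph.
    simple_graph G \<and> card (edges G) = m \<and> graph_free F G}"
  have "?counts \<subseteq> {..nat \<lfloor>B\<rfloor>}" using bound by (auto simp: le_nat_floor)
  then have fin: "finite ?counts" by (rule finite_subset) simp
  have count_G: "card (copies H G) \<in> ?counts" using G by blast
  then show "card (copies H G) \<le> mex m H F" unfolding mex_def using fin by (rule Max_ge[rotated])
  have "mex m H F \<in> ?counts" unfolding mex_def using fin count_G by (intro Max_in) auto
  then show "real (mex m H F) \<le> B" using bound by auto
qed

lemma card_copies_complete_graph_le_powr:
  assumes G: "simple_graph G" and \<alpha>: "\<alpha> \<ge> 1" and C: "C \<ge> 0"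
    and neighbours_le: "\<And>v W. v \<in> verts G \<Longrightarrow> W \<subseteq> neighbours (adj G) (verts G) v \<Longrightarrow>
      real (card (cliques (adj G) W q)) \<le> C * real (card W) powr \<alpha>"
  shows "real (card (copies (complete_graph (Suc q)) G))
    \<le> C * (2 * real (card (edges G))) powr ((\<alpha> + 1) / 2)"
proof -
  have "real (card (copies (complete_graph (Suc q)) G))
      \<le> C * real (card (arcs (adj G) (verts G) (verts G))) powr ((\<alpha> + 1) / 2)"
    unfolding card_copies_complete_graph[OF G]
    using G by (intro cliques_Suc_le_arcs_powr \<alpha> C neighbours_le) (auto simp: simple_graph_def)
  also have "\<dots> \<le> C * (2 * real (card (edges G))) powr ((\<alpha> + 1) / 2)"
    using C \<alpha> of_nat_mono[OF card_arcs_adj_le[OF G], where ?'a = real]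
    by (intro mult_left_mono powr_mono2) auto
  finally show ?thesis .
qed

lemma finite_subset_neighbours:
  "simple_graph G \<Longrightarrow> W \<subseteq> neighbours (adj G) (verts G) v \<Longrightarrow> finite W"
  by (meson finite_neighbours finite_subset simple_graph_def)

lemma card_copies_complete_graph_le:
  assumes G: "simple_graph G" and r: "r \<ge> 2"
  shows "real (card (copies (complete_graph r) G)) \<le> (2 * real (card (edges G))) powr (real r / 2)"
proof -
  obtain q where r_eq: "r = Suc q" "q \<ge> 1" using r by (cases r) auto
  have "real (card (cliques (adj G) W q)) \<le> 1 * real (card W) powr real q"
    if "W \<subseteq> neighbours (adj G) (verts G) v" for v W
    using cliques_le_card_powr[OF finite_subset_neighbours[OF G that] r_eq(2)] by simp
  then have "real (card (copies (complete_graph (Suc q)) G))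
      \<le> 1 * (2 * real (card (edges G))) powr ((real q + 1) / 2)"
    using r_eq(2) by (intro card_copies_complete_graph_le_powr[OF G]) auto
  then show ?thesis by (simp add: r_eq(1) add.commute)
qed

lemma card_copies_clique_join_cycle_free_le:
  assumes G: "simple_graph G" "graph_free (clique_join_cycle s l) G"
    and s: "s \<ge> 1" and l: "l \<ge> 2" and r: "r \<ge> s + 2 + l mod 2"
  shows "real (card (copies (complete_graph r) G))
    \<le> clique_const l
      * (2 * real (card (edges G))) powr ((real s + 1) / 2 + 1 / (2 * real (l div 2)))"
proof -
  obtain q where r_eq: "r = Suc q" using r by (cases r) auto
  obtain s' where s_eq: "s = Suc s'" using s by (cases s) auto
  let ?\<alpha> = "real s' + 1 + 1 / real (l div 2)"
  have no_join: "\<not> has_clique_join_cycle (adj G) (verts G) (Suc s') l"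
    using graph_free_no_clique_join_cycle[OF G(1) l G(2)] s_eq by simp
  note adj = symp_adj irreflp_adj[OF G(1)]
  have "real (card (cliques (adj G) W q)) \<le> clique_const l * real (card W) powr ?\<alpha>"
    if v: "v \<in> verts G" and W: "W \<subseteq> neighbours (adj G) (verts G) v" for v W
  proof -
    have "\<not> has_clique_join_cycle (adj G) (neighbours (adj G) (verts G) v) s' l"
      using no_join has_clique_join_cycle_Suc[OF adj _ v] G(1) by (auto simp: simple_graph_def)
    then have "\<not> has_clique_join_cycle (adj G) W s' l"
      using has_clique_join_cycle_mono[OF _ W] by blast
    then show ?thesis
      using r r_eq s_eq finite_subset_neighbours[OF G(1) W]
      by (intro clique_join_cycle_free_cliques_powr[OF adj _ _ l]) auto
  qed
  then have "real (card (copies (complete_graph r) G))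
      \<le> clique_const l * (2 * real (card (edges G))) powr ((?\<alpha> + 1) / 2)"
    unfolding r_eq by (intro card_copies_complete_graph_le_powr[OF G(1)] clique_const_nonneg) auto
  moreover have "(?\<alpha> + 1) / 2 = (real s + 1) / 2 + 1 / (2 * real (l div 2))"
    by (simp add: s_eq field_simps)
  ultimately show ?thesis by (simp only:)
qed

section \<open>The asymptotic behaviour of mex\<close>

lemma mex_bigo_powr:
  assumes host: "\<And>m. \<exists>G :: nat sgraph. simple_graph G \<and> card (edges G) = m \<and> graph_free F G"
    and bound: "\<And>G :: nat sgraph. simple_graph G \<Longrightarrow> graph_free F G \<Longrightarrow>
      real (card (copies H G)) \<le> C * (2 * real (card (edges G))) powr \<beta>"
  shows "(\<lambda>m. real (mex m H F)) \<in> O(\<lambda>m. real m powr \<beta>)"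
proof (intro bigoI[of _ "C * 2 powr \<beta>"] always_eventually allI)
  fix m
  obtain G :: "nat sgraph" where G: "simple_graph G" "card (edges G) = m" "graph_free F G"
    using host[of m] by blast
  have "real (mex m H F) \<le> C * (2 * real m) powr \<beta>"
    by (rule mex_le[OF _ G]) (use bound in auto)
  then show "norm (real (mex m H F)) \<le> C * 2 powr \<beta> * norm (real m powr \<beta>)"
    by (simp add: powr_mult mult.assoc)
qed

lemma ex_part_size:
  assumes r: "r \<ge> 1" and m: "4 * r\<^sup>2 \<le> m"
  shows "\<exists>a. (r * a)\<^sup>2 \<le> m \<and> (1 / (2 * real r)) ^ r * real m powr (real r / 2) \<le> real (a ^ r)"
proof -
  define y where "y = sqrt (real m) / real r"
  have "(2 * real r)\<^sup>2 \<le> real m"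
    using of_nat_mono[OF m, where ?'a = real] by (simp add: power_mult_distrib)
  then have "2 * real r \<le> sqrt (real m)" by (rule real_le_rsqrt)
  then have "y \<ge> 2" unfolding y_def using r by (simp add: field_simps)
  define a where "a = nat \<lfloor>y\<rfloor>"
  have a_bounds: "real a \<le> y" "y / 2 \<le> real a" unfolding a_def using \<open>y \<ge> 2\<close> by linarith+
  have "real (r * a) \<le> sqrt (real m)" using a_bounds(1) r by (simp add: y_def field_simps)
  then have "real ((r * a)\<^sup>2) \<le> real m"
    using power_mono[of "real (r * a)" "sqrt (real m)" 2] by simp
  then have "(r * a)\<^sup>2 \<le> m" by (simp only: of_nat_le_iff)
  moreover have "m > 0" using m r by (cases m) auto
  then have "real m powr (real r / 2) = sqrt (real m) ^ r"
    by (simp add: powr_powr flip: powr_half_sqrt powr_realpow)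
  then have "(1 / (2 * real r)) ^ r * real m powr (real r / 2) = (y / 2) ^ r"
    by (simp add: y_def power_divide power_mult_distrib)
  moreover have "(y / 2) ^ r \<le> real (a ^ r)"
    using a_bounds(2) \<open>y \<ge> 2\<close> power_mono[of "y / 2" "real a" r] by simp
  ultimately show ?thesis by auto
qed

lemma mex_clique_join_cycle_bigo:
  assumes "s \<ge> 1" "l \<ge> 2" "r \<ge> s + 2 + l mod 2"
  shows "(\<lambda>m. real (mex m (complete_graph r) (clique_join_cycle s l)))
    \<in> O(\<lambda>m. real m powr ((real s + 1) / 2 + 1 / (2 * real (l div 2))))"
proof (rule mex_bigo_powr)
  show "\<exists>G :: nat sgraph. simple_graph G \<and> card (edges G) = m
      \<and> graph_free (clique_join_cycle s l) G" for m
    using ex_clique_join_cycle_free_graph[of 2 s l 0 m] assms by auto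
qed (rule card_copies_clique_join_cycle_free_le[OF _ _ assms])

lemma mex_clique_join_cycle_bigtheta:
  assumes "r \<ge> 2" "l \<ge> 2" "r < s + 2 + l mod 2"
  shows "(\<lambda>m. real (mex m (complete_graph r) (clique_join_cycle s l)))
    \<in> \<Theta>(\<lambda>m. real m powr (real r / 2))"
proof (rule bigthetaI)
  let ?F = "clique_join_cycle s l"
  note host = ex_clique_join_cycle_free_graph[OF assms(1,3,2)]
  show "(\<lambda>m. real (mex m (complete_graph r) ?F)) \<in> O(\<lambda>m. real m powr (real r / 2))"
  proof (rule mex_bigo_powr[where C = 1])
    show "\<exists>G :: nat sgraph. simple_graph G \<and> card (edges G) = m \<and> graph_free ?F G" for m
      using host[of 0 m] by auto
  qed (simp add: card_copies_complete_graph_le[OF _ assms(1)])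
  show "(\<lambda>m. real (mex m (complete_graph r) ?F)) \<in> \<Omega>(\<lambda>m. real m powr (real r / 2))"
  proof (rule landau_omega.bigI)
    show "(1 / (2 * real r)) ^ r > 0" using assms(1) by simp
    show "\<forall>\<^sub>F m in sequentially. norm (real (mex m (complete_graph r) ?F))
        \<ge> (1 / (2 * real r)) ^ r * norm (real m powr (real r / 2))"
      using eventually_ge_at_top[of "4 * r\<^sup>2"]
    proof eventually_elim
      case (elim m)
      then obtain a where part_size: "(r * a)\<^sup>2 \<le> m"
        "(1 / (2 * real r)) ^ r * real m powr (real r / 2) \<le> real (a ^ r)"
        using ex_part_size[of r m] assms(1) by auto
      obtain G :: "nat sgraph" where G: "simple_graph G" "card (edges G) = m" "graph_free ?F G"
        and "a ^ r \<le> card (copies (complete_graph r) G)"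
        using host[OF part_size(1)] by blast
      moreover have "card (copies (complete_graph r) G) \<le> mex m (complete_graph r) ?F"
        by (rule card_copies_le_mex[OF _ G, where B = "(2 * real m) powr (real r / 2)"])
          (use card_copies_complete_graph_le[OF _ assms(1)] in auto)
      ultimately have "real (a ^ r) \<le> real (mex m (complete_graph r) ?F)" by simp
      from order_trans[OF part_size(2) this] show ?case by simp
    qed
  qed
qed

theorem theorem4p9:
  fixes r l s :: nat
  assumes "r \<ge> 3" and "l \<ge> 4" and "s \<ge> 1"
  shows "(\<forall>t::nat. t \<ge> 2 \<and> (l = 2 * t \<and> r \<ge> s + 2 \<or> l = 2 * t + 1 \<and> r \<ge> s + 3) \<longrightarrow>
            (\<lambda>m. real (mex m (complete_graph r) (graph_join (complete_graph s) (cycle_graph l))))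
              \<in> O(\<lambda>m. real m powr ((real s + 1) / 2 + 1 / (2 * real t))))
       \<and> (\<not> (\<exists>t::nat. t \<ge> 2 \<and> (l = 2 * t \<and> r \<ge> s + 2 \<or> l = 2 * t + 1 \<and> r \<ge> s + 3)) \<longrightarrow>
            (\<lambda>m. real (mex m (complete_graph r) (graph_join (complete_graph s) (cycle_graph l))))
              \<in> \<Theta>(\<lambda>m. real m powr (real r / 2)))"
proof -
  have "t \<ge> 2 \<and> (l = 2 * t \<and> r \<ge> s + 2 \<or> l = 2 * t + 1 \<and> r \<ge> s + 3)
      \<longleftrightarrow> t = l div 2 \<and> s + 2 + l mod 2 \<le> r" for t
    using assms(2) by presburger
  then show ?thesis
    using mex_clique_join_cycle_bigo[of s l r] mex_clique_join_cycle_bigtheta[of r l s] assms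
    by auto
qed

end
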